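(* Let $1\le m\le q$ and let $\mathbf{P}_{m+1}=(P_\infty,P_1,\ldots,P_m)$ on the curve $\mathcal{Y}_{n,s}$. For $(i,j)\in\mathcal{I}$ let $$\alpha^{i,j,m}:=\left((q^2-m)(q+1)M-iqM-jq^3,\ iM+j,\ldots,iM+j\right)\in\mathbb{Z}^{m+1}.$$ Then $$\widehat{\Gamma}(\mathbf{P}_{m+1})\cap\mathcal{C}_{m+1}=\{\alpha^{i,j,m} : (i,j)\in\mathcal{I}\}\cup\{\mathbf{0}\}.$$
   Context: Let $q$ be a prime power, $n\ge 3$ an odd integer, $s$ a positive divisor of $\frac{q^n+1}{q+1}$, and $M=\frac{q^n+1}{s(q+1)}$. $\mathcal{Y}_{n,s}$ is the nonsingular projective geometrically irreducible curve over $\mathbb{F}_{q^{2n}}$ given by the affine equations $x^q+x=y^{q+1}$ and $y^{q^2}-y=z^M$. $P_\infty$ is the unique common pole of $x,y,z$; $\alpha_1,\ldots,\alpha_q$ are the distinct roots of $x^q+x$, and $P_i$ is the rational point $(x,y,z)=(\alpha_i,0,0)$, $1\le i\le q$. $\mathcal{I}:=\{(i,j)\in\mathbb{Z}^2: 0\le i\le q,\ 1\le j\le M\}\setminus\{(q,M)\}$. Generalized Weierstrass semigroup: for an $r$-tuple $\mathbf{Q}=(Q_1,\ldots,Q_r)$ of distinct rational points on a curve, $\widehat{H}(\mathbf{Q})=\{(-v_{Q_1}(h),\ldots,-v_{Q_r}(h)) : h\ne 0 \text{ a rational function regular outside } \{Q_1,\ldots,Q_r\}\}\subseteq\mathbb{Z}^r$,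 where $v_Q$ is the discrete valuation at $Q$. For $\alpha\in\mathbb{Z}^r$ and nonempty $J\subsetneq\{1,\ldots,r\}$, $\nabla_J(\alpha):=\{\beta\in\widehat{H}(\mathbf{Q}):\beta_j=\alpha_j\ (j\in J),\ \beta_i<\alpha_i\ (i\notin J)\}$. An element $\alpha\in\widehat{H}(\mathbf{Q})$ is absolute maximal if $\nabla_J(\alpha)=\emptyset$ for every nonempty $J\subsetneq\{1,\ldots,r\}$. $\widehat{\Gamma}(\mathbf{Q})$ is the set of absolute maximal elements of $\widehat{H}(\mathbf{Q})$. $\mathcal{C}_{m+1}:=\{\beta\in\mathbb{Z}^{m+1}: 0\le\beta_i<(q+1)M \text{ for } i=2,\ldots,m+1\}$. *)

theory Defs
  imports
    "HOL-Number_Theory.Prime_Powers"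
    "HOL-Computational_Algebra.Polynomial"
begin

section \<open>The function field of the curve\<close>

text \<open>
  The nonsingular projective curve is handled through its function field, which is the whole
  type \<open>'f\<close>; the field of constants is a set \<open>k\<close> of elements of \<open>'f\<close>.
\<close>

definition is_subfield :: "'f::field set \<Rightarrow> bool" where
  "is_subfield k \<longleftrightarrow>
     0 \<in> k \<and> 1 \<in> k \<and>
     (\<forall>a\<in>k. \<forall>b\<in>k. a - b \<in> k \<and> a * b \<in> k) \<and>
     (\<forall>a\<in>k. inverse a \<in> k)"

definition transcendental_over :: "'f::field set \<Rightarrow> 'f \<Rightarrow> bool" where
  "transcendental_over k t \<longleftrightarrow>
     (\<forall>p. p \<noteq> 0 \<and> (\<forall>i. coeff p i \<in> k) \<longrightarrow> poly p t \<noteq> 0)"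

definition generates_field_over :: "'f::field set \<Rightarrow> 'f set \<Rightarrow> bool" where
  "generates_field_over k S \<longleftrightarrow> (\<forall>L. is_subfield L \<and> k \<union> S \<subseteq> L \<longrightarrow> L = UNIV)"

text \<open>
  The field \<open>'f = k(x, y, z)\<close> is the function field of the curve over \<open>k = GF(q^(2*n))\<close> with
  affine equations \<open>x^q + x = y^(q+1)\<close> and \<open>y^(q^2) - y = z^M\<close>.  By the equations \<open>y\<close> and \<open>z\<close>
  are algebraic over \<open>k(x)\<close>, so transcendence of \<open>x\<close> says exactly that \<open>'f\<close> has
  transcendence degree one over \<open>k\<close>.
\<close>

definition function_field_Y ::
  "nat \<Rightarrow> nat \<Rightarrow> nat \<Rightarrow> 'f::field set \<Rightarrow> 'f \<Rightarrow> 'f \<Rightarrow> 'f \<Rightarrow> bool" where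
  "function_field_Y q n M k x y z \<longleftrightarrow>
     is_subfield k \<and> card k = q ^ (2 * n) \<and>
     generates_field_over k {x, y, z} \<and> transcendental_over k x \<and>
     x ^ q + x = y ^ (q + 1) \<and> y ^ (q\<^sup>2) - y = z ^ M"

section \<open>Points\<close>

text \<open>
  The (closed) points of the nonsingular projective curve with function field \<open>'f\<close> over \<open>k\<close>
  are the normalised discrete valuations of \<open>'f\<close> that are trivial on \<open>k\<close>.  A valuation is
  integer-valued; its value at \<open>0\<close> (mathematically infinity) is set to the dummy \<open>0\<close>, so that
  distinct points are distinct functions.  Hence positivity and nonnegativity of \<open>v h\<close>
  must be read for \<open>h \<noteq> 0\<close>.
\<close>

definition places :: "'f::field set \<Rightarrow> ('f \<Rightarrow> int) set" where
  "places k = {v.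
     v 0 = 0 \<and>
     (\<forall>a b. a \<noteq> 0 \<and> b \<noteq> 0 \<longrightarrow> v (a * b) = v a + v b) \<and>
     (\<forall>a b. a \<noteq> 0 \<and> b \<noteq> 0 \<and> a + b \<noteq> 0 \<longrightarrow> min (v a) (v b) \<le> v (a + b)) \<and>
     (\<forall>c\<in>k. v c = 0) \<and>
     (\<exists>t. v t = 1)}"

definition regular_at :: "('f::field \<Rightarrow> int) \<Rightarrow> 'f \<Rightarrow> bool" where
  "regular_at v h \<longleftrightarrow> h = 0 \<or> 0 \<le> v h"

definition has_value_at :: "('f::field \<Rightarrow> int) \<Rightarrow> 'f \<Rightarrow> 'f \<Rightarrow> bool" where
  "has_value_at v h c \<longleftrightarrow> h = c \<or> 0 < v (h - c)"

text \<open>A point is rational if its residue field is \<open>k\<close>.\<close>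

definition rational_places :: "'f::field set \<Rightarrow> ('f \<Rightarrow> int) set" where
  "rational_places k = {v \<in> places k. \<forall>h. regular_at v h \<longrightarrow> (\<exists>c\<in>k. has_value_at v h c)}"

section \<open>Generalized Weierstrass semigroups\<close>

text \<open>
  An \<open>r\<close>-tuple of points or of integers is a list of length \<open>r\<close>; positions are counted from \<open>0\<close>.
\<close>

definition gen_weierstrass :: "'f::field set \<Rightarrow> ('f \<Rightarrow> int) list \<Rightarrow> int list set" where
  "gen_weierstrass k Q =
     {map (\<lambda>v. - v h) Q | h. h \<noteq> 0 \<and> (\<forall>v \<in> places k - set Q. regular_at v h)}"

definition nabla ::
  "'f::field set \<Rightarrow> ('f \<Rightarrow> int) list \<Rightarrow> nat set \<Rightarrow> int list \<Rightarrow> int list set" where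
  "nabla k Q J \<alpha> =
     {\<beta> \<in> gen_weierstrass k Q.
        (\<forall>j\<in>J. \<beta> ! j = \<alpha> ! j) \<and> (\<forall>i \<in> {..<length Q} - J. \<beta> ! i < \<alpha> ! i)}"

definition abs_maximal :: "'f::field set \<Rightarrow> ('f \<Rightarrow> int) list \<Rightarrow> int list set" where
  "abs_maximal k Q =
     {\<alpha> \<in> gen_weierstrass k Q.
        \<forall>J. J \<noteq> {} \<and> J \<subset> {..<length Q} \<longrightarrow> nabla k Q J \<alpha> = {}}"

section \<open>The index set, the box and the explicit tuples\<close>

definition index_set :: "nat \<Rightarrow> nat \<Rightarrow> (int \<times> int) set" where
  "index_set q M = ({0..int q} \<times> {1..int M}) - {(int q, int M)}"

definition box :: "nat \<Rightarrow> nat \<Rightarrow> nat \<Rightarrow> int list set" where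
  "box q M m =
     {\<beta>. length \<beta> = m + 1 \<and> (\<forall>i\<in>{1..m}. 0 \<le> \<beta> ! i \<and> \<beta> ! i < (int q + 1) * int M)}"

definition alpha_tuple :: "nat \<Rightarrow> nat \<Rightarrow> nat \<Rightarrow> int \<Rightarrow> int \<Rightarrow> int list" where
  "alpha_tuple q M m i j =
     (((int q)\<^sup>2 - int m) * (int q + 1) * int M - i * int q * int M - j * int q ^ 3)
     # replicate m (i * int M + j)"

end

theory Submission
  imports
    "HOL-Algebra.Algebraic_Closure_Type"
    Defs
    "HOL-Computational_Algebra.Polynomial_FPS"
    "HOL-Library.Product_Plus"
begin

text \<open>
  Write \<open>E = (q + 1) M\<close>, \<open>F = k(x, y, z)\<close> and \<open>A = k[x, y, z]\<close>.

  By the equations of the curve every element of \<open>A\<close> is a sum of terms \<open>r(x) y^b z^d\<close> with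
  \<open>0 \<le> b \<le> q\<close> and \<open>0 \<le> d < M\<close>.  At a pole of \<open>x\<close> the functions \<open>x, y, z\<close> have pole orders \<open>E\<close>,
  \<open>q M\<close>, \<open>q^3\<close>; at a zero of \<open>x - a\<close> with \<open>a^q + a = 0\<close> the functions \<open>x - a, y, z\<close> vanish to
  the orders \<open>E\<close>, \<open>M\<close>, \<open>1\<close>.  So at each of these places terms with different \<open>(b, d)\<close> have values
  in different classes modulo \<open>E\<close>, and the value of a sum is the least value of its nonzero terms.
  In particular the values of \<open>x, y, z\<close> determine the place (\<open>weighs_unique\<close>).

  The geometric input is that \<open>A\<close> contains every function regular at all places where \<open>x\<close> has no
  pole (\<open>regular_at_finite_places\<close>).  It holds because the affine curve is unramified over the
  \<open>z\<close>-line: the equations \<open>y^(q^2) - y = z^M\<close> and \<open>x^q + x = y^(q+1)\<close> can be solved in power series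
  in \<open>z - c\<close> at each of the \<open>q^3\<close> points over \<open>z = c\<close>, with coefficients in an algebraic closure.
  Each solution embeds \<open>A\<close> into a power series ring, and the order of vanishing yields a place
  (\<open>place_at_branch\<close>).  If \<open>g / h(z)\<close> with \<open>g \<in> A\<close> is regular at these places and \<open>h(c) = 0\<close>, then
  \<open>g\<close> vanishes at all \<open>q^3\<close> points over \<open>c\<close>.  Hence all coefficients of \<open>g\<close> with respect to the
  basis \<open>y^i x^j\<close>, \<open>i < q^2\<close>, \<open>j < q\<close>, of \<open>A\<close> over \<open>k[z]\<close> vanish at \<open>c\<close>, and the denominator can be
  cancelled.

  A function regular off \<open>P_inf, P_1, \<dots>, P_m\<close> therefore lies in \<open>A\<close> after multiplication by a power of
  \<open>\<Prod>(x - \<alpha>_l)\<close>.  It is a sum of components \<open>r(x) y^b z^d / \<Prod>(x - \<alpha>_l)^N\<close>, each again regular off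
  the points, and its vector of pole orders is the coordinatewise maximum of those of the
  components (\<open>decomposition\<close>).  If this vector is absolute maximal, it equals the vector of one
  component, since a component attaining one coordinate is bounded by it in all others; removing
  from \<open>r\<close> the factors other than the \<open>x - \<alpha>_l\<close> lowers only the first coordinate, so even a monomial
  \<open>\<Prod>(x - \<alpha>_l)^(e_l) y^b z^d\<close> with integers \<open>e_l\<close> has the same vector
  (\<open>abs_maximal_is_component\<close>).

  Conversely the vectors of these monomials are absolute maximal.  A function that agrees with the
  monomial in one coordinate and does not exceed it in any other has a component with the same
  \<open>(b, d)\<close>, and this component is bounded by the monomial everywhere.  But the sum of all coordinates
  of a component is \<open>E (deg r - \<Sum> ord_l r)\<close> plus a constant depending on \<open>(b, d)\<close>, which is
  smallest for the monomials, so no coordinate can be smaller (\<open>component_abs_maximal\<close>).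

  For a monomial the \<open>l\<close>-th coordinate is \<open>- E e_l - M b - d\<close> with \<open>0 \<le> M b + d < E\<close>.  In the box
  this leaves \<open>e_l = 0\<close> for all \<open>l\<close> if \<open>b = d = 0\<close>, and \<open>e_l = -1\<close> for all \<open>l\<close> otherwise; the latter
  monomial yields the tuple of \<open>i = q - b\<close>, \<open>j = M - d\<close>.
\<close>

section \<open>Polynomials over a subring\<close>

definition is_subring :: "'a::comm_ring_1 set \<Rightarrow> bool" where
  "is_subring B \<longleftrightarrow> 0 \<in> B \<and> 1 \<in> B \<and> (\<forall>a\<in>B. \<forall>b\<in>B. a - b \<in> B \<and> a * b \<in> B)"

lemma is_subringD:
  assumes "is_subring B"
  shows "0 \<in> B" "1 \<in> B"
    "\<And>a b. a \<in> B \<Longrightarrow> b \<in> B \<Longrightarrow> a - b \<in> B"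
    "\<And>a b. a \<in> B \<Longrightarrow> b \<in> B \<Longrightarrow> a * b \<in> B"
    "\<And>a. a \<in> B \<Longrightarrow> - a \<in> B"
    "\<And>a b. a \<in> B \<Longrightarrow> b \<in> B \<Longrightarrow> a + b \<in> B"
proof -
  show 0: "0 \<in> B" and "1 \<in> B" and d: "\<And>a b. a \<in> B \<Longrightarrow> b \<in> B \<Longrightarrow> a - b \<in> B"
    and "\<And>a b. a \<in> B \<Longrightarrow> b \<in> B \<Longrightarrow> a * b \<in> B"
    using assms unfolding is_subring_def by auto
  show m: "- a \<in> B" if "a \<in> B" for a
    using d[OF 0 that] by simp
  show "a + b \<in> B" if "a \<in> B" "b \<in> B" for a b
    using d[OF that(1) m[OF that(2)]] by simp
qed

lemma is_subring_sum:
  assumes "is_subring B" "\<And>i. i \<in> I \<Longrightarrow> f i \<in> B"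
  shows "sum f I \<in> B"
  using assms(2) by (induction I rule: infinite_finite_induct) (auto simp: is_subringD[OF assms(1)])

lemma is_subfield_imp_subring: "is_subfield k \<Longrightarrow> is_subring k"
  by (simp add: is_subfield_def is_subring_def)

definition polys_over :: "'a::comm_ring_1 set \<Rightarrow> 'a poly set" where
  "polys_over B = {p. \<forall>i. coeff p i \<in> B}"

context
  fixes B :: "'a::comm_ring_1 set"
  assumes B: "is_subring B"
begin

lemma polys_over_0 [intro, simp]: "0 \<in> polys_over B"
  by (simp add: polys_over_def is_subringD[OF B])

lemma polys_over_pCons [simp]: "pCons a p \<in> polys_over B \<longleftrightarrow> a \<in> B \<and> p \<in> polys_over B"
  by (auto simp: polys_over_def coeff_pCons split: nat.splits)

lemma polys_over_monom: "a \<in> B \<Longrightarrow> monom a n \<in> polys_over B"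
  by (simp add: polys_over_def is_subringD[OF B])

lemma polys_over_1 [intro, simp]: "1 \<in> polys_over B"
  using polys_over_monom[of 1 0] by (simp add: is_subringD[OF B] monom_0 one_pCons)

lemma polys_over_smult: "a \<in> B \<Longrightarrow> p \<in> polys_over B \<Longrightarrow> smult a p \<in> polys_over B"
  by (simp add: polys_over_def is_subringD[OF B])

lemma polys_over_add: "p \<in> polys_over B \<Longrightarrow> r \<in> polys_over B \<Longrightarrow> p + r \<in> polys_over B"
  by (simp add: polys_over_def is_subringD[OF B])

lemma polys_over_diff: "p \<in> polys_over B \<Longrightarrow> r \<in> polys_over B \<Longrightarrow> p - r \<in> polys_over B"
  by (simp add: polys_over_def is_subringD[OF B])

lemma polys_over_minus: "p \<in> polys_over B \<Longrightarrow> - p \<in> polys_over B"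
  by (simp add: polys_over_def is_subringD[OF B])

lemma polys_over_mult: "p \<in> polys_over B \<Longrightarrow> r \<in> polys_over B \<Longrightarrow> p * r \<in> polys_over B"
  by (auto simp: polys_over_def coeff_mult intro!: is_subring_sum[OF B] is_subringD(4)[OF B])

lemma polys_over_power: "p \<in> polys_over B \<Longrightarrow> p ^ n \<in> polys_over B"
  by (induction n) (auto intro: polys_over_mult)

lemma polys_over_prod: "(\<And>i. i \<in> I \<Longrightarrow> f i \<in> polys_over B) \<Longrightarrow> prod f I \<in> polys_over B"
  by (induction I rule: infinite_finite_induct) (auto intro: polys_over_mult)

lemma poly_polys_over_mem:
  assumes A: "is_subring A" and "B \<subseteq> A" "w \<in> A" "p \<in> polys_over B"
  shows "poly p w \<in> A"
  using assms(4)
proof (induction p)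
  case (pCons a p)
  then show ?case using assms by (auto intro!: is_subringD[OF A])
qed (simp add: is_subringD[OF A])

end

lemma synthetic_div_over:
  assumes B: "is_subring B" and "r \<in> polys_over B" "a \<in> B"
  shows "synthetic_div r a \<in> polys_over B"
  using assms(2)
proof (induction r)
  case (pCons c r)
  with poly_polys_over_mem[OF B B order.refl assms(3)] show ?case by (simp add: B)
qed (simp add: B)

section \<open>Algebraic elements\<close>

text \<open>
  The usual division fails because \<open>B\<close> need not contain inverses; multiplying the dividend by a
  power of the leading coefficient of \<open>G\<close> keeps all coefficients in \<open>B\<close>.
\<close>
lemma pseudo_division_over:
  fixes B :: "'a::idom set"
  assumes B: "is_subring B" and G: "G \<in> polys_over B" "G \<noteq> 0" and P: "P \<in> polys_over B"
  obtains l Q R where "l \<in> B" "l \<noteq> 0" "Q \<in> polys_over B" "R \<in> polys_over B"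
    "smult l P = Q * G + R" "R = 0 \<or> degree R < degree G"
proof -
  define c where "c = lead_coeff G"
  have c: "c \<in> B" "c \<noteq> 0" using G by (auto simp: c_def polys_over_def)
  have "\<exists>l Q R. l \<in> B \<and> l \<noteq> 0 \<and> Q \<in> polys_over B \<and> R \<in> polys_over B \<and>
          smult l P = Q * G + R \<and> (R = 0 \<or> degree R < degree G)"
    using P
  proof (induction "degree P" arbitrary: P rule: less_induct)
    case less
    show ?case
    proof (cases "degree P < degree G \<or> degree G = 0")
      case True
      then show ?thesis
      proof
        assume "degree P < degree G"
        then show ?thesis using less.prems B
          by (intro exI[of _ 1] exI[of _ 0] exI[of _ P]) (auto simp: is_subringD[OF B])
      next
        assume "degree G = 0"
        then obtain g where "G = [:g:]" by (rule degree_eq_zeroE)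
        with c have "G = [:c:]" by (simp add: c_def)
        then show ?thesis using less.prems c B
          by (intro exI[of _ c] exI[of _ P] exI[of _ 0]) auto
      qed
    next
      case False
      define a where "a = lead_coeff P"
      define T where "T = monom a (degree P - degree G)"
      define P' where "P' = smult c P - T * G"
      have a: "a \<in> B" using less.prems by (auto simp: a_def polys_over_def)
      have T: "T \<in> polys_over B" unfolding T_def by (rule polys_over_monom[OF B a])
      have P': "P' \<in> polys_over B"
        unfolding P'_def using less.prems c T G B
        by (intro polys_over_diff polys_over_smult polys_over_mult)
      have "degree (T * G) \<le> degree P"
        using False degree_mult_le[of T G] degree_monom_le[of a "degree P - degree G"]
        unfolding T_def by linarith
      hence "degree P' \<le> degree P"
        unfolding P'_def by (intro degree_diff_le) (auto intro: order.trans[OF degree_smult_le])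
      moreover have "coeff P' (degree P) = 0"
        using False by (simp add: P'_def T_def coeff_monom_mult c_def a_def)
      ultimately have "P' = 0 \<or> degree P' < degree P" by (rule eq_zero_or_degree_less)
      hence "degree P' < degree P" using False by auto
      from less.hyps[OF this P'] obtain l Q R where *: "l \<in> B" "l \<noteq> 0" "Q \<in> polys_over B"
        "R \<in> polys_over B" "smult l P' = Q * G + R" "R = 0 \<or> degree R < degree G" by auto
      have "smult (l * c) P = smult l P' + smult l T * G"
        by (simp add: P'_def smult_diff_right)
      also have "\<dots> = (Q + smult l T) * G + R" by (simp add: * algebra_simps)
      finally show ?thesis using * c T B
        by (intro exI[of _ "l * c"] exI[of _ "Q + smult l T"] exI[of _ R])
           (auto intro!: is_subringD(4)[OF B] polys_over_add[OF B] polys_over_smult[OF B])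
    qed
  qed
  thus ?thesis using that by blast
qed

text \<open>
  The inverse of an algebraic element is, up to a denominator from \<open>B\<close>, a polynomial in that
  element.  The element \<open>Q\<close> is found as in the Euclidean algorithm for \<open>P\<close> and an annihilating
  polynomial of \<open>w\<close> of least degree: each remainder is a multiple of \<open>P(w)\<close>, and the degrees
  decrease to a constant.
\<close>
lemma algebraic_adjunction_multiple:
  fixes B :: "'a::idom set"
  assumes B: "is_subring B" and m0: "m0 \<in> polys_over B" "m0 \<noteq> 0" "poly m0 w = 0"
    and P: "P \<in> polys_over B" "poly P w \<noteq> 0"
  obtains Q where "Q \<in> polys_over B" "poly P w * poly Q w \<in> B" "poly P w * poly Q w \<noteq> 0"
proof -
  define S where "S = {m. m \<in> polys_over B \<and> m \<noteq> 0 \<and> poly m w = 0}"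
  obtain m where m: "m \<in> S" and min: "\<And>r. r \<in> S \<Longrightarrow> degree m \<le> degree r"
    using m0 ex_min_if_finite exists_least_iff[of "\<lambda>n. \<exists>m\<in>S. degree m = n"]
    unfolding S_def by (metis (mono_tags, lifting) mem_Collect_eq not_le)
  hence mB: "m \<in> polys_over B" "m \<noteq> 0" "poly m w = 0" by (auto simp: S_def)
  have "\<exists>Q\<in>polys_over B. poly P w * poly Q w \<in> B \<and> poly P w * poly Q w \<noteq> 0"
    using P
  proof (induction "degree P" arbitrary: P rule: less_induct)
    case less
    have P0: "P \<noteq> 0" using less.prems by auto
    consider "degree P = 0" | "degree P > degree m" | "degree P > 0" "degree P \<le> degree m"
      by linarith
    then show ?case
    proof cases
      case 1
      then obtain a where "P = [:a:]" by (rule degree_eq_zeroE)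
      with less.prems B show ?thesis by (intro bexI[of _ 1]) auto
    next
      case 2
      obtain l Q R where *: "l \<in> B" "l \<noteq> 0" "Q \<in> polys_over B"
        "R \<in> polys_over B" "smult l P = Q * m + R" "R = 0 \<or> degree R < degree m"
        by (rule pseudo_division_over[OF B mB(1,2) less.prems(1)])
      have R: "l * poly P w = poly R w"
        using arg_cong[OF *(5), of "\<lambda>p. poly p w"] mB by simp
      hence "poly R w \<noteq> 0" using *(2) less.prems by auto
      moreover from this have "degree R < degree P" using *(6) 2 by auto
      ultimately obtain Q' where Q': "Q' \<in> polys_over B"
        "poly R w * poly Q' w \<in> B" "poly R w * poly Q' w \<noteq> 0"
        using less.hyps[of R] *(4) by auto
      have "poly R w * poly Q' w = poly P w * poly (smult l Q') w"
        using R by (simp add: mult_ac)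
      with Q' show ?thesis by (metis polys_over_smult[OF B *(1)])
    next
      case 3
      obtain l Q R where *: "l \<in> B" "l \<noteq> 0" "Q \<in> polys_over B"
        "R \<in> polys_over B" "smult l m = Q * P + R" "R = 0 \<or> degree R < degree P"
        by (rule pseudo_division_over[OF B less.prems(1) P0 mB(1)])
      have R: "poly R w = - (poly Q w * poly P w)"
        using arg_cong[OF *(5), of "\<lambda>p. poly p w"] mB by (simp add: add_eq_0_iff)
      \<comment> \<open>otherwise \<open>Q\<close> would annihilate \<open>w\<close> and have smaller degree than \<open>m\<close>\<close>
      have "poly R w \<noteq> 0"
      proof
        assume "poly R w = 0"
        hence Qw: "poly Q w = 0" using R less.prems by auto
        have Q0: "Q \<noteq> 0"
        proof
          assume "Q = 0"
          hence "smult l m = R" using * by simp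
          hence "degree m < degree P" using * mB by auto
          thus False using 3 by simp
        qed
        have "degree m \<le> degree Q" using min[of Q] Q0 Qw * by (auto simp: S_def)
        moreover have "degree (Q * P) = degree m"
        proof -
          have "Q * P = smult l m - R" using * by simp
          moreover have "degree (smult l m - R) = degree m"
          proof (cases "R = 0")
            case False
            hence "degree (- R) < degree (smult l m)" using *(2,6) 3 by simp
            from degree_add_eq_left[OF this] have "degree (smult l m + - R) = degree (smult l m)" .
            thus ?thesis using *(2) by simp
          qed (use *(2) in simp)
          ultimately show ?thesis by simp
        qed
        ultimately show False using Q0 P0 3 by (simp add: degree_mult_eq)
      qed
      moreover from this have "degree R < degree P" using *(6) by auto
      ultimately obtain Q' where Q': "Q' \<in> polys_over B"
        "poly R w * poly Q' w \<in> B" "poly R w * poly Q' w \<noteq> 0"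
        using less.hyps[of R] *(4) by auto
      have "poly R w * poly Q' w = poly P w * poly (- (Q * Q')) w"
        using R by (simp add: mult_ac)
      with Q' * show ?thesis
        by (metis polys_over_minus[OF B] polys_over_mult[OF B])
    qed
  qed
  thus ?thesis using that by blast
qed

definition adjoin :: "'a::comm_ring_1 set \<Rightarrow> 'a \<Rightarrow> 'a set" where
  "adjoin B w = (\<lambda>P. poly P w) ` polys_over B"

lemma adjoin:
  assumes B: "is_subring B"
  shows "is_subring (adjoin B w)" "B \<subseteq> adjoin B w" "w \<in> adjoin B w"
proof -
  show "B \<subseteq> adjoin B w"
  proof
    fix b assume "b \<in> B"
    hence "[:b:] \<in> polys_over B" by (simp add: B)
    from imageI[OF this, of "\<lambda>P. poly P w"] show "b \<in> adjoin B w" by (simp add: adjoin_def)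
  qed
  have "[:0, 1:] \<in> polys_over B" using is_subringD[OF B] by (simp add: B)
  from imageI[OF this, of "\<lambda>P. poly P w"] show "w \<in> adjoin B w" by (simp add: adjoin_def)
  have "a - b \<in> adjoin B w \<and> a * b \<in> adjoin B w" if "a \<in> adjoin B w" "b \<in> adjoin B w" for a b
  proof -
    from that obtain P R where *: "P \<in> polys_over B" "R \<in> polys_over B" "a = poly P w" "b = poly R w"
      by (auto simp: adjoin_def)
    have "poly (P - R) w \<in> adjoin B w" "poly (P * R) w \<in> adjoin B w"
      unfolding adjoin_def using * by (intro imageI polys_over_diff[OF B] polys_over_mult[OF B]; simp)+
    thus ?thesis using * by simp
  qed
  thus "is_subring (adjoin B w)"
    using \<open>B \<subseteq> adjoin B w\<close> is_subringD(1,2)[OF B] by (auto simp: is_subring_def)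
qed

section \<open>Integer valuations\<close>

text \<open>The value at \<open>0\<close> is unconstrained, so all rules below speak of nonzero elements.\<close>
definition int_valuation :: "('f::field \<Rightarrow> int) \<Rightarrow> bool" where
  "int_valuation v \<longleftrightarrow>
     (\<forall>a b. a \<noteq> 0 \<and> b \<noteq> 0 \<longrightarrow> v (a * b) = v a + v b) \<and>
     (\<forall>a b. a \<noteq> 0 \<and> b \<noteq> 0 \<and> a + b \<noteq> 0 \<longrightarrow> min (v a) (v b) \<le> v (a + b))"

lemma places_iff:
  "v \<in> places k \<longleftrightarrow> int_valuation v \<and> v 0 = 0 \<and> (\<forall>c\<in>k. v c = 0) \<and> (\<exists>t. v t = 1)"
  by (auto simp: places_def int_valuation_def)

context
  fixes v :: "'f::field \<Rightarrow> int"
  assumes v: "int_valuation v"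
begin

lemma val_mult: "a \<noteq> 0 \<Longrightarrow> b \<noteq> 0 \<Longrightarrow> v (a * b) = v a + v b"
  using v by (auto simp: int_valuation_def)

lemma val_add_ge: "a \<noteq> 0 \<Longrightarrow> b \<noteq> 0 \<Longrightarrow> a + b \<noteq> 0 \<Longrightarrow> min (v a) (v b) \<le> v (a + b)"
  using v by (auto simp: int_valuation_def)

lemma val_1 [simp]: "v 1 = 0"
  using val_mult[of 1 1] by simp

lemma val_minus [simp]: "v (- a) = v a"
proof (cases "a = 0")
  case False
  have "v (-1) + v (-1) = 0" using val_mult[of "-1" "-1"] by simp
  hence "v (-1) = 0" by simp
  with val_mult[of "-1" a] False show ?thesis by simp
qed simp

lemma val_power: "a \<noteq> 0 \<Longrightarrow> v (a ^ n) = int n * v a"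
  by (induction n) (auto simp: val_mult algebra_simps)

lemma val_prod: "(\<And>i. i \<in> I \<Longrightarrow> f i \<noteq> 0) \<Longrightarrow> v (prod f I) = (\<Sum>i\<in>I. v (f i))"
  by (induction I rule: infinite_finite_induct) (auto simp: val_mult)

lemma val_divide: "a \<noteq> 0 \<Longrightarrow> b \<noteq> 0 \<Longrightarrow> v (a / b) = v a - v b"
  using val_mult[of "a / b" b] by simp

lemma val_add_eq:
  assumes "a \<noteq> 0" "b \<noteq> 0" "v a < v b"
  shows "a + b \<noteq> 0" "v (a + b) = v a"
proof -
  show nz: "a + b \<noteq> 0"
  proof
    assume "a + b = 0"
    hence "b = - a" by (simp add: add_eq_0_iff)
    thus False using assms by simp
  qed
  have "v a \<le> v (a + b)" using val_add_ge[OF assms(1,2) nz] assms(3) by simp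
  moreover have "min (v (a + b)) (v (- b)) \<le> v (a + b + - b)"
    using assms nz by (intro val_add_ge) auto
  ultimately show "v (a + b) = v a" using assms(3) by auto
qed

text \<open>Without ties the ultrametric inequality is an equality.\<close>
lemma val_sum_separated:
  assumes "finite I" "\<And>i j. i \<in> I \<Longrightarrow> j \<in> I \<Longrightarrow> t i \<noteq> 0 \<Longrightarrow> t j \<noteq> 0 \<Longrightarrow> i \<noteq> j \<Longrightarrow> v (t i) \<noteq> v (t j)"
    and "\<exists>i\<in>I. t i \<noteq> 0"
  shows "sum t I \<noteq> 0 \<and> (\<exists>i\<in>I. t i \<noteq> 0 \<and> v (sum t I) = v (t i)) \<and>
           (\<forall>i\<in>I. t i \<noteq> 0 \<longrightarrow> v (sum t I) \<le> v (t i))"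
  using assms
proof (induction I rule: finite_induct)
  case (insert a I)
  show ?case
  proof (cases "\<exists>i\<in>I. t i \<noteq> 0")
    case False
    hence "sum t I = 0" by (intro sum.neutral) auto
    with False insert show ?thesis by auto
  next
    case True
    have IH: "sum t I \<noteq> 0" "\<exists>i\<in>I. t i \<noteq> 0 \<and> v (sum t I) = v (t i)"
        "\<And>i. i \<in> I \<Longrightarrow> t i \<noteq> 0 \<Longrightarrow> v (sum t I) \<le> v (t i)"
      using insert.IH[OF insert.prems(1) True] by blast+
    show ?thesis
    proof (cases "t a = 0")
      case True
      thus ?thesis using IH insert.hyps by auto
    next
      case False
      from IH(2) obtain i where i: "i \<in> I" "t i \<noteq> 0" "v (sum t I) = v (t i)" by auto
      have ne: "v (t a) \<noteq> v (sum t I)"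
        using i insert.prems(1)[of a i] insert.hyps False by auto
      have eq: "sum t (insert a I) = t a + sum t I" "sum t (insert a I) = sum t I + t a"
        using insert.hyps by (auto simp: add.commute)
      show ?thesis
      proof (cases "v (t a) < v (sum t I)")
        case True
        with val_add_eq[of "t a" "sum t I"] IH(1) False
        have "sum t (insert a I) \<noteq> 0" "v (sum t (insert a I)) = v (t a)" by (auto simp: eq(1))
        moreover have "v (t a) \<le> v (t i)" if "i \<in> I" "t i \<noteq> 0" for i
          using IH(3)[OF that] True by linarith
        ultimately show ?thesis using False by auto
      next
        case lt: False
        with val_add_eq[of "sum t I" "t a"] IH(1) False ne
        have "sum t (insert a I) \<noteq> 0" "v (sum t (insert a I)) = v (sum t I)"
          by (auto simp: eq(2))
        with lt IH i show ?thesis by auto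
      qed
    qed
  qed
qed auto

end

text \<open>
  The values form a subgroup of the integers, so the least positive value \<open>d\<close> divides all of them.
  This turns an order of vanishing into a place without finding a local parameter in the
  field.
\<close>
lemma normalise_valuation:
  fixes w :: "'a::field \<Rightarrow> int"
  assumes w: "int_valuation w" "w 0 = 0" "\<And>c. c \<in> k \<Longrightarrow> w c = 0" and pos: "\<exists>f. w f > 0"
  obtains d where "d > 0" "\<And>f. d dvd w f" "(\<lambda>f. w f div d) \<in> places k"
proof -
  define d where "d = (LEAST n. n > 0 \<and> (\<exists>f. w f = int n))"
  from pos obtain f0 where "w f0 > 0" by auto
  hence "\<exists>n. n > 0 \<and> (\<exists>f. w f = int n)" by (intro exI[of _ "nat (w f0)"]) auto
  from LeastI_ex[OF this] obtain u where d: "d > 0" "w u = int d" by (auto simp: d_def)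
  have least: "d \<le> n" if "n > 0" "w f = int n" for n f
    unfolding d_def using that by (intro Least_le) auto
  have u0: "u \<noteq> 0" using d w by auto
  have dvd: "int d dvd w f" for f
  proof (cases "f = 0")
    case False
    define r where "r = w f div int d"
    have "\<exists>g. w g = w f mod int d"
    proof (cases "r \<ge> 0")
      case True
      have "w (f / u ^ nat r) = w f - r * int d"
        using False u0 d True by (simp add: val_divide[OF w(1)] val_power[OF w(1)])
      thus ?thesis unfolding r_def minus_div_mult_eq_mod by blast
    next
      case r: False
      have "w (f * u ^ nat (- r)) = w f - r * int d"
        using False u0 d r by (simp add: val_mult[OF w(1)] val_power[OF w(1)])
      thus ?thesis unfolding r_def minus_div_mult_eq_mod by blast
    qed
    then obtain g where g: "w g = w f mod int d" by blast
    have "w f mod int d = 0"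
    proof (rule ccontr)
      assume "w f mod int d \<noteq> 0"
      hence *: "w f mod int d > 0" using d pos_mod_sign[of "int d" "w f"] by linarith
      hence "d \<le> nat (w f mod int d)" using g by (intro least[of _ g]) simp_all
      thus False using * d pos_mod_bound[of "int d" "w f"] by linarith
    qed
    thus ?thesis by auto
  qed (use w in auto)
  have "(\<lambda>f. w f div int d) \<in> places k"
    unfolding places_iff int_valuation_def
  proof (intro conjI allI impI ballI)
    fix a b :: 'a assume "a \<noteq> 0 \<and> b \<noteq> 0"
    thus "w (a * b) div int d = w a div int d + w b div int d"
      using dvd[of a] by (auto simp: val_mult[OF w(1)] div_plus_div_distrib_dvd_left)
  next
    fix a b :: 'a assume *: "a \<noteq> 0 \<and> b \<noteq> 0 \<and> a + b \<noteq> 0"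
    have "min (w a) (w b) \<le> w (a + b)" using * by (intro val_add_ge[OF w(1)]) auto
    thus "min (w a div int d) (w b div int d) \<le> w (a + b) div int d"
      using d zdiv_mono1[of "w a" "w (a + b)" "int d"] zdiv_mono1[of "w b" "w (a + b)" "int d"] by linarith
  next
    show "\<exists>t. w t div int d = 1" using d by (intro exI[of _ u]) auto
  qed (use w in auto)
  thus ?thesis using that[of "int d"] d dvd by auto
qed

lemma regular_subring:
  assumes "v \<in> places k"
  shows "is_subring {h. regular_at v h}"
proof -
  have v: "int_valuation v" "v 0 = 0" using assms by (auto simp: places_iff)
  have "regular_at v (a - b)" if "regular_at v a" "regular_at v b" for a b
  proof (cases "a = 0 \<or> b = 0 \<or> a = b")
    case False
    hence "min (v a) (v (- b)) \<le> v (a + - b)" by (intro val_add_ge[OF v(1)]) auto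
    thus ?thesis using that False by (auto simp: regular_at_def val_minus[OF v(1)])
  qed (use that in \<open>auto simp: regular_at_def val_minus[OF v(1)]\<close>)
  moreover have "regular_at v (a * b)" if "regular_at v a" "regular_at v b" for a b
    using that by (cases "a = 0"; cases "b = 0") (auto simp: regular_at_def val_mult[OF v(1)])
  ultimately show ?thesis
    using v by (auto simp: is_subring_def regular_at_def[of v 0] regular_at_def[of v 1] val_1[OF v(1)])
qed

section \<open>Artin-Schreier equations in characteristic p\<close>

lemma frobenius_add:
  fixes a b :: "'a::comm_semiring_1"
  assumes "prime (p::nat)" "of_nat p = (0::'a)" "q = p ^ e" "(1::'a) \<noteq> 0"
  shows "(a + b) ^ q = a ^ q + b ^ q"
proof -
  have "CHAR('a) dvd p" using assms(2) by (simp add: of_nat_eq_0_iff_char_dvd)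
  moreover have "CHAR('a) \<noteq> 1" using assms(4) CHAR_not_1' by auto
  ultimately have "CHAR('a) = p" using assms(1) by (auto simp: prime_nat_iff)
  with assms show ?thesis using freshmans_dream'[of q e a b] by simp
qed

lemma frobenius_sum:
  fixes f :: "'b \<Rightarrow> 'a::comm_semiring_1"
  assumes "prime (p::nat)" "of_nat p = (0::'a)" "q = p ^ e" "(1::'a) \<noteq> 0"
  shows "(\<Sum>i\<in>I. f i) ^ q = (\<Sum>i\<in>I. f i ^ q)"
proof -
  have "q > 0" using assms prime_gt_0_nat by simp
  thus ?thesis
    by (induction I rule: infinite_finite_induct) (auto simp: frobenius_add[OF assms] power_0_left)
qed

text \<open>
  Additivity of the Frobenius power gives the formula for polynomials; coefficients of
  \<open>f\<close> beyond the \<open>n\<close>-th do not influence the \<open>n\<close>-th coefficient of \<open>f^q\<close>.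
\<close>
lemma fps_nth_power_frobenius:
  fixes f :: "'a::field fps"
  assumes p: "prime (p::nat)" "of_nat p = (0::'a)" and q: "q = p ^ e"
  shows "(f ^ q) $ n = (if q dvd n then (f $ (n div q)) ^ q else 0)"
proof -
  have q0: "q > 0" using p q prime_gt_0_nat by simp
  have pf: "of_nat p = (0 :: 'a fps)" using p(2) by (simp add: fps_of_nat[symmetric])
  define g where "g = (\<Sum>i\<le>n. fps_const (f $ i) * fps_X ^ i)"
  define h where "h = fps_shift (Suc n) f"
  have "f = g + h * fps_X ^ Suc n"
  proof (rule fps_ext)
    fix j
    have "g $ j = (if j \<le> n then f $ j else 0)"
      by (simp add: g_def fps_sum_nth fps_X_power_iff if_distrib[of "\<lambda>x. _ * x"] cong: if_cong)
    thus "f $ j = (g + h * fps_X ^ Suc n) $ j"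
      by (simp add: h_def fps_X_power_mult_right_nth del: power_Suc)
  qed
  hence "f ^ q = g ^ q + h ^ q * fps_X ^ (Suc n * q)"
    by (simp add: frobenius_add[OF p(1) pf q] power_mult_distrib power_mult[symmetric] del: power_Suc mult_Suc)
  moreover have "n < Suc n * q" using q0 by (metis lessI less_le_trans mult.right_neutral mult_le_mono2 Suc_leI One_nat_def)
  ultimately have "(f ^ q) $ n = (g ^ q) $ n"
    by (simp add: fps_X_power_mult_right_nth del: power_Suc mult_Suc)
  also have "g ^ q = (\<Sum>i\<le>n. fps_const ((f $ i) ^ q) * fps_X ^ (i * q))"
    unfolding g_def by (subst frobenius_sum[OF p(1) pf q])
      (simp_all add: power_mult_distrib power_mult[symmetric] fps_const_power)
  also have "\<dots> $ n = (\<Sum>i\<le>n. if n = i * q then (f $ i) ^ q else 0)"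
    by (simp add: fps_sum_nth fps_X_power_iff if_distrib[of "\<lambda>x. _ * x"] cong: if_cong)
  also have "\<dots> = (\<Sum>i\<le>n. if i = n div q then (if q dvd n then (f $ i) ^ q else 0) else 0)"
    using q0 by (intro sum.cong) auto
  also have "\<dots> = (if q dvd n then (f $ (n div q)) ^ q else 0)" by simp
  finally show ?thesis .
qed

text \<open>
  Comparing coefficients in \<open>w^Q + c w = u\<close> expresses the \<open>n\<close>-th coefficient of \<open>w\<close> by the
  \<open>(n / Q)\<close>-th one.  The case \<open>Q < 2\<close>, where this would not be a recursion, is cut off.
\<close>
function artin_schreier_coeff :: "nat \<Rightarrow> 'a::field \<Rightarrow> (nat \<Rightarrow> 'a) \<Rightarrow> nat \<Rightarrow> 'a" where
  "artin_schreier_coeff Q c u n = (if n = 0 \<or> Q < 2 then 0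
     else (u n - (if Q dvd n then artin_schreier_coeff Q c u (n div Q) ^ Q else 0)) / c)"
  by pat_completeness auto
termination by (relation "measure (\<lambda>(_, _, _, n). n)") auto

declare artin_schreier_coeff.simps [simp del]

lemma fps_artin_schreier:
  fixes u :: "'a::field fps"
  assumes p: "prime (p::nat)" "of_nat p = (0::'a)" and q: "q = p ^ e" "q \<ge> 2"
    and c: "c \<noteq> 0" and u: "u $ 0 = 0"
  obtains w where "w $ 0 = 0" "w ^ q + fps_const c * w = u"
proof -
  define w where "w = Abs_fps (artin_schreier_coeff q c (\<lambda>n. u $ n))"
  have w0: "w $ 0 = 0" by (simp add: w_def artin_schreier_coeff.simps)
  have "w ^ q + fps_const c * w = u"
  proof (rule fps_ext)
    fix n
    show "(w ^ q + fps_const c * w) $ n = u $ n"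
    proof (cases "n = 0")
      case True
      thus ?thesis using w0 u q(2) by (simp add: fps_power_zeroth)
    next
      case False
      have "w $ n = (u $ n - (if q dvd n then (w $ (n div q)) ^ q else 0)) / c"
        unfolding w_def fps_nth_Abs_fps by (subst artin_schreier_coeff.simps) (use False q in auto)
      thus ?thesis using c by (simp add: fps_nth_power_frobenius[OF p q(1)])
    qed
  qed
  with w0 that show ?thesis by blast
qed

text \<open>
  All roots lie in the field and are simple, so they can be split off one after the other from
  both polynomials.
\<close>
lemma simple_roots_dvd:
  fixes P g :: "'a::alg_closed_field poly"
  assumes "P \<noteq> 0" "\<And>b. poly P b = 0 \<Longrightarrow> poly (pderiv P) b \<noteq> 0"
    and "\<And>b. poly P b = 0 \<Longrightarrow> poly g b = 0"
  shows "P dvd g"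
  using assms
proof (induction "degree P" arbitrary: P g)
  case 0
  then obtain c where "P = [:c:]" by (metis degree_eq_zeroE)
  with 0 show ?case by (simp add: const_poly_dvd_iff dvd_field_iff)
next
  case (Suc n)
  obtain b where b: "poly P b = 0" using alg_closed_imp_poly_has_root[of P] Suc by auto
  then obtain P' where P: "P = [:- b, 1:] * P'" by (metis dvdE poly_eq_0_iff_dvd)
  obtain g' where g: "g = [:- b, 1:] * g'" using Suc.prems(3)[OF b] by (metis dvdE poly_eq_0_iff_dvd)
  have P'0: "P' \<noteq> 0" using Suc.prems P by auto
  have d: "poly (pderiv P) c = (c - b) * poly (pderiv P') c + poly P' c" for c
    unfolding P pderiv_mult by (simp add: pderiv_pCons algebra_simps)
  have "P' dvd g'"
  proof (rule Suc.hyps(1))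
    show "n = degree P'" using Suc.hyps(2) P'0 unfolding P by (subst (asm) degree_mult_eq) auto
    fix c assume c: "poly P' c = 0"
    hence "poly P c = 0" by (simp add: P)
    hence 1: "(c - b) * poly (pderiv P') c \<noteq> 0" "poly g c = 0" using Suc.prems(2,3)[of c] d c by auto
    thus "poly (pderiv P') c \<noteq> 0" by auto
    show "poly g' c = 0" using 1 by (auto simp: g algebra_simps)
  qed (rule P'0)
  thus ?case unfolding P g by (intro mult_dvd_mono) auto
qed

text \<open>
  The polynomial \<open>T^q + c T - d\<close> has derivative \<open>c \<noteq> 0\<close>, hence \<open>q\<close> different roots, too many for \<open>g\<close>.
\<close>
lemma vanishing_on_artin_schreier_roots:
  fixes g :: "'a::alg_closed_field poly"
  assumes q: "of_nat q = (0::'a)" "q \<ge> 2" and c: "c \<noteq> 0" and deg: "degree g < q"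
    and van: "\<And>b. b ^ q + c * b = d \<Longrightarrow> poly g b = 0"
  shows "g = 0"
proof (rule ccontr)
  assume g: "g \<noteq> 0"
  define P where "P = monom 1 q + [:- d, c:]"
  have P: "poly P b = b ^ q + c * b - d" for b by (simp add: P_def poly_monom algebra_simps)
  have "pderiv P = [:c:]" using q by (simp add: P_def pderiv_add pderiv_monom pderiv_pCons)
  moreover have dP: "degree P = q"
    unfolding P_def using q c by (subst degree_add_eq_left) (auto simp: degree_monom_eq)
  ultimately have "P dvd g" using q c van by (intro simple_roots_dvd) (auto simp: P)
  thus False using dvd_imp_degree_le[of P g] g deg dP by simp
qed

section \<open>Reduction of monomials\<close>

text \<open>
  Here \<open>T r (b, d)\<close> stands for a coefficient \<open>r\<close> times the \<open>b\<close>-th and \<open>d\<close>-th powers of two fixed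
  elements.
\<close>
definition reduced_sums :: "('s \<Rightarrow> nat \<times> nat \<Rightarrow> 'm::comm_monoid_add) \<Rightarrow> 's set \<Rightarrow> nat \<Rightarrow> nat \<Rightarrow> 'm set" where
  "reduced_sums T S B D = {\<Sum>i\<in>{..<B} \<times> {..<D}. T (r i) i | r. \<forall>i. r i \<in> S}"

text \<open>
  Rewriting rules that lower one exponent: the first keeps the other exponent, the second may raise
  it.  They are used for \<open>k[x, y, z]\<close> over \<open>k[x]\<close>, and for pairs of an element over \<open>k[z]\<close> and its
  power series, so that one reduction produces the same coefficients for both.
\<close>
locale monomial_reduction =
  fixes T :: "'s::comm_monoid_add \<Rightarrow> nat \<times> nat \<Rightarrow> 'm::comm_monoid_add" and S B D
  assumes S0: "0 \<in> S" and Sadd: "r \<in> S \<Longrightarrow> s \<in> S \<Longrightarrow> r + s \<in> S"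
    and T0: "T 0 i = 0" and Tadd: "r \<in> S \<Longrightarrow> s \<in> S \<Longrightarrow> T (r + s) i = T r i + T s i"
    and reduce1: "s \<in> S \<Longrightarrow> B \<le> b \<Longrightarrow>
      \<exists>r1\<in>S. \<exists>r2\<in>S. \<exists>b1<b. \<exists>b2<b. T s (b, d) = T r1 (b1, d) + T r2 (b2, d)"
    and reduce2: "s \<in> S \<Longrightarrow> D \<le> d \<Longrightarrow>
      \<exists>r1\<in>S. \<exists>r2\<in>S. \<exists>b1 b2. \<exists>d1<d. \<exists>d2<d. T s (b, d) = T r1 (b1, d1) + T r2 (b2, d2)"
begin

abbreviation N where "N \<equiv> reduced_sums T S B D"

lemma reduced_add: "a \<in> N \<Longrightarrow> c \<in> N \<Longrightarrow> a + c \<in> N"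
proof -
  assume "a \<in> N" "c \<in> N"
  then obtain r s where *: "a = (\<Sum>i\<in>{..<B} \<times> {..<D}. T (r i) i)" "c = (\<Sum>i\<in>{..<B} \<times> {..<D}. T (s i) i)"
    "\<forall>i. r i \<in> S" "\<forall>i. s i \<in> S" by (auto simp: reduced_sums_def)
  have "a + c = (\<Sum>i\<in>{..<B} \<times> {..<D}. T (r i) i + T (s i) i)" unfolding * sum.distrib ..
  also have "\<dots> = (\<Sum>i\<in>{..<B} \<times> {..<D}. T (r i + s i) i)"
    using *(3,4) by (intro sum.cong refl Tadd[symmetric]) auto
  finally have "a + c = (\<Sum>i\<in>{..<B} \<times> {..<D}. T (r i + s i) i)" .
  thus ?thesis using * unfolding reduced_sums_def
    by (intro CollectI exI[of _ "\<lambda>i. r i + s i"]) (auto intro: Sadd)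
qed

text \<open>
  The second exponent is lowered first; since this may raise the first one, the first exponent is
  treated for a small second exponent only.
\<close>
lemma reduced_term:
  assumes "s \<in> S" shows "T s (b, d) \<in> N"
proof -
  have small: "T s (b, d) \<in> N" if "s \<in> S" "b < B" "d < D" for s b d
  proof -
    have "(\<Sum>i\<in>{..<B} \<times> {..<D}. T (if i = (b, d) then s else 0) i) =
        (\<Sum>i\<in>{..<B} \<times> {..<D}. if i = (b, d) then T s i else 0)"
      by (intro sum.cong) (auto simp: T0)
    also have "\<dots> = T s (b, d)" using that by simp
    finally show ?thesis unfolding reduced_sums_def using that
      by (intro CollectI exI[of _ "\<lambda>i. if i = (b, d) then s else 0"]) (auto simp: S0)
  qed
  have small_d: "T s (b, d) \<in> N" if "s \<in> S" "d < D" for s b d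
    using that(1)
  proof (induction b arbitrary: s rule: less_induct)
    case (less b)
    show ?case
    proof (cases "b < B")
      case False
      then obtain r1 r2 b1 b2 where "r1 \<in> S" "r2 \<in> S" "b1 < b" "b2 < b"
        "T s (b, d) = T r1 (b1, d) + T r2 (b2, d)" using reduce1[OF less.prems, of b d] by auto
      thus ?thesis using reduced_add less.IH by simp
    qed (use small less.prems that in auto)
  qed
  show ?thesis using assms
  proof (induction d arbitrary: b s rule: less_induct)
    case (less d)
    show ?case
    proof (cases "d < D")
      case False
      then obtain r1 r2 b1 b2 d1 d2 where "r1 \<in> S" "r2 \<in> S" "d1 < d" "d2 < d"
        "T s (b, d) = T r1 (b1, d1) + T r2 (b2, d2)" using reduce2[OF less.prems, of d b] by fastforce
      thus ?thesis using reduced_add less.IH by simp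
    qed (use small_d less.prems in auto)
  qed
qed

lemma reduced_sum:
  assumes "\<And>l. l \<in> L \<Longrightarrow> t l \<in> N" shows "sum t L \<in> N"
proof -
  have "0 \<in> N" unfolding reduced_sums_def
    by (intro CollectI exI[of _ "\<lambda>_. 0"]) (auto simp: T0 S0)
  with assms show ?thesis
    by (induction L rule: infinite_finite_induct) (auto intro: reduced_add)
qed

end

section \<open>The coordinate ring of the curve\<close>

inductive_set coordinate_ring :: "'f::field set \<Rightarrow> 'f \<Rightarrow> 'f \<Rightarrow> 'f \<Rightarrow> 'f set"
  for k x y z where
  const: "c \<in> k \<Longrightarrow> c \<in> coordinate_ring k x y z"
| add: "f \<in> coordinate_ring k x y z \<Longrightarrow> g \<in> coordinate_ring k x y z \<Longrightarrow> f + g \<in> coordinate_ring k x y z"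
| mult_x: "f \<in> coordinate_ring k x y z \<Longrightarrow> f * x \<in> coordinate_ring k x y z"
| mult_y: "f \<in> coordinate_ring k x y z \<Longrightarrow> f * y \<in> coordinate_ring k x y z"
| mult_z: "f \<in> coordinate_ring k x y z \<Longrightarrow> f * z \<in> coordinate_ring k x y z"

text \<open>
  The place \<open>P_inf\<close> belongs to the setting
  because the independence of the monomials is read off from its values.
\<close>
locale curve =
  fixes p e q M :: nat and k :: "'f::field set" and x y z :: 'f and P_inf :: "'f \<Rightarrow> int"
  assumes prime_p: "prime p" and e_pos: "e > 0" and q_eq: "q = p ^ e"
    and char_p: "of_nat p = (0::'f)"
    and M_pos: "M > 0" and coprime_M_q: "coprime M q"
    and k: "is_subfield k" and gen: "generates_field_over k {x, y, z}"
    and eq_xy: "x ^ q + x = y ^ (q + 1)" and eq_yz: "y ^ (q\<^sup>2) - y = z ^ M"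
    and P_inf: "P_inf \<in> places k" and P_inf_x: "P_inf x < 0"
begin

abbreviation A where "A \<equiv> coordinate_ring k x y z"

abbreviation E :: int where "E \<equiv> (int q + 1) * int M"

lemma kring: "is_subring k"
  using k by (rule is_subfield_imp_subring)

lemma q_ge_2: "q \<ge> 2"
proof -
  have "p ^ 1 \<le> p ^ e" using e_pos prime_gt_0_nat[OF prime_p] by (intro power_increasing) auto
  thus ?thesis using prime_ge_2_nat[OF prime_p] q_eq by simp
qed

lemma placeD:
  assumes "v \<in> places k"
  shows "int_valuation v" "v 0 = 0" "c \<in> k \<Longrightarrow> v c = 0" "\<exists>t. v t = 1"
  using assms by (auto simp: places_iff)

lemma A_subring: "is_subring A"
proof -
  have k01: "0 \<in> k" "1 \<in> k" "-1 \<in> k" using is_subringD[OF kring] by auto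
  have cm: "c * f \<in> A" if "f \<in> A" "c \<in> k" for c f
    using that by (induction f rule: coordinate_ring.induct)
      (auto simp: distrib_left mult.assoc[symmetric] intro: coordinate_ring.intros is_subringD(4)[OF kring])
  have mult: "g * f \<in> A" if "f \<in> A" "g \<in> A" for f g
    using that
  proof (induction f rule: coordinate_ring.induct)
    case (const c) thus ?case using cm[of g c] by (simp add: mult.commute)
  qed (auto simp: distrib_left mult.assoc[symmetric] intro: coordinate_ring.intros)
  have "f - g \<in> A" if "f \<in> A" "g \<in> A" for f g
    using coordinate_ring.add[OF that(1) cm[OF that(2) k01(3)]] by simp
  thus ?thesis using mult k01 by (auto simp: is_subring_def intro: coordinate_ring.const)
qed

lemma k_subset_A: "k \<subseteq> A" by (auto intro: coordinate_ring.const)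

lemma xyz_in_A: "x \<in> A" "y \<in> A" "z \<in> A"
  using coordinate_ring.mult_x[of 1 k x y z] coordinate_ring.mult_y[of 1 k x y z]
    coordinate_ring.mult_z[of 1 k x y z] is_subringD[OF A_subring] by auto

lemma A_power: "f \<in> A \<Longrightarrow> f ^ n \<in> A"
  by (induction n) (auto intro: is_subringD[OF A_subring])

lemma A_poly: "r \<in> polys_over k \<Longrightarrow> f \<in> A \<Longrightarrow> poly r f \<in> A"
  by (rule poly_polys_over_mem[OF kring A_subring k_subset_A])

text \<open>The fractions of \<open>A\<close> form a subfield that contains the generators of the function field.\<close>
lemma fraction:
  obtains a b where "a \<in> A" "b \<in> A" "b \<noteq> 0" "f = a / b"
proof -
  note A = is_subringD[OF A_subring]
  define L where "L = {a / b | a b. a \<in> A \<and> b \<in> A \<and> b \<noteq> 0}"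
  have sub: "g - h \<in> L" and mul: "g * h \<in> L" if "g \<in> L" "h \<in> L" for g h
  proof -
    from that obtain a b c d where *: "g = a / b" "h = c / d" "a \<in> A" "b \<in> A" "c \<in> A" "d \<in> A"
      "b \<noteq> 0" "d \<noteq> 0" by (auto simp: L_def)
    have "g - h = (a * d - c * b) / (b * d)" "g * h = (a * c) / (b * d)"
      using * by (simp_all add: field_simps)
    moreover have "a * d - c * b \<in> A" "b * d \<in> A" "a * c \<in> A" "b * d \<noteq> 0" using * A by auto
    ultimately show "g - h \<in> L" "g * h \<in> L" unfolding L_def by blast+
  qed
  have inv: "inverse g \<in> L" if "g \<in> L" for g
  proof -
    from that obtain a b where *: "g = a / b" "a \<in> A" "b \<in> A" "b \<noteq> 0" by (auto simp: L_def)
    show ?thesis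
    proof (cases "a = 0")
      case True
      with * have "inverse g = 0 / 1" by simp
      thus ?thesis using A(1,2) unfolding L_def
        by (intro CollectI exI[of _ 0] exI[of _ 1]) auto
    next
      case False
      have "inverse g = b / a" using * by simp
      thus ?thesis using * False unfolding L_def by (intro CollectI exI[of _ b] exI[of _ a]) auto
    qed
  qed
  have AL: "A \<subseteq> L"
  proof
    fix a assume "a \<in> A"
    moreover have "a = a / 1" by simp
    ultimately show "a \<in> L" using A(2) unfolding L_def by (intro CollectI exI[of _ a] exI[of _ 1]) auto
  qed
  have "is_subfield L" using sub mul inv AL A by (auto simp: is_subfield_def)
  moreover have "k \<union> {x, y, z} \<subseteq> L" using AL k_subset_A xyz_in_A by auto
  ultimately have "L = UNIV" using gen by (auto simp: generates_field_over_def)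
  thus ?thesis using that by (auto simp: L_def)
qed

lemma places_eqI:
  assumes "v \<in> places k" "v' \<in> places k" "\<And>a. a \<in> A \<Longrightarrow> a \<noteq> 0 \<Longrightarrow> v a = v' a"
  shows "v = v'"
proof
  fix f
  obtain a b where *: "a \<in> A" "b \<in> A" "b \<noteq> 0" "f = a / b" by (rule fraction)
  show "v f = v' f"
    using * assms(3) placeD[OF assms(1)] placeD[OF assms(2)]
    by (cases "a = 0") (auto simp: val_divide)
qed

section \<open>The coordinate ring as a module over the polynomials in x\<close>

definition x_term :: "'f poly \<Rightarrow> nat \<times> nat \<Rightarrow> 'f" where
  "x_term r i = poly r x * y ^ fst i * z ^ snd i"

abbreviation Idx :: "(nat \<times> nat) set" where "Idx \<equiv> {..<q + 1} \<times> {..<M}"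

definition x_sum :: "(nat \<times> nat \<Rightarrow> 'f poly) \<Rightarrow> 'f" where
  "x_sum r = (\<Sum>i\<in>Idx. x_term (r i) i)"

text \<open>
  The equation \<open>y^(q+1) = x^q + x\<close> lowers the exponent of \<open>y\<close> by \<open>q + 1\<close>, and
  \<open>z^M = y^(q^2) - y\<close> lowers the exponent of \<open>z\<close> by \<open>M\<close> at the cost of powers of \<open>y\<close>.
\<close>
lemma A_eq_x_sum:
  assumes "f \<in> A"
  obtains r where "\<And>i. r i \<in> polys_over k" "f = x_sum r"
proof -
  interpret R: monomial_reduction x_term "polys_over k" "q + 1" M
  proof
    fix s b d assume s: "s \<in> polys_over k" and "q + 1 \<le> b"
    define b' where "b' = b - (q + 1)"
    have b: "b = b' + (q + 1)" using \<open>q + 1 \<le> b\<close> by (simp add: b'_def)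
    have yb: "y ^ b = y ^ b' * (x ^ q + x)" unfolding b power_add eq_xy by simp
    have "x_term s (b, d) = x_term (s * (monom 1 q + monom 1 1)) (b', d) + x_term 0 (b', d)"
      unfolding x_term_def fst_conv snd_conv yb by (simp add: poly_monom mult_ac)
    moreover have "s * (monom 1 q + monom 1 1) \<in> polys_over k"
      using s by (intro polys_over_mult polys_over_add polys_over_monom kring is_subringD(2)[OF kring])
    ultimately show "\<exists>r1\<in>polys_over k. \<exists>r2\<in>polys_over k. \<exists>b1<b. \<exists>b2<b.
        x_term s (b, d) = x_term r1 (b1, d) + x_term r2 (b2, d)"
      using b kring
      by (intro bexI[of _ "s * (monom 1 q + monom 1 1)"] bexI[of _ 0] exI[of _ b'] conjI) auto
  next
    fix s b d assume s: "s \<in> polys_over k" and "M \<le> d"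
    define d' where "d' = d - M"
    have d: "d = d' + M" using \<open>M \<le> d\<close> by (simp add: d'_def)
    have zd: "z ^ d = z ^ d' * (y ^ (q\<^sup>2) - y)" unfolding d power_add eq_yz by simp
    have "x_term s (b, d) = x_term s (b + q\<^sup>2, d') + x_term (- s) (b + 1, d')"
      unfolding x_term_def fst_conv snd_conv zd by (simp add: power_add algebra_simps)
    moreover have "d' < d" "- s \<in> polys_over k"
      using s d M_pos by (auto intro: polys_over_minus[OF kring])
    ultimately show "\<exists>r1\<in>polys_over k. \<exists>r2\<in>polys_over k. \<exists>b1 b2. \<exists>d1<d. \<exists>d2<d.
        x_term s (b, d) = x_term r1 (b1, d1) + x_term r2 (b2, d2)"
      using s by blast
  qed (auto simp: x_term_def kring algebra_simps intro: polys_over_add[OF kring])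
  have "f \<in> R.N" using assms
  proof (induction f rule: coordinate_ring.induct)
    case (const c)
    hence "x_term [:c:] (0, 0) \<in> R.N" by (intro R.reduced_term) (simp add: kring)
    moreover have "x_term [:c:] (0, 0) = c" by (simp add: x_term_def)
    ultimately show ?case by simp
  next
    case (mult_x f)
    then obtain r where r: "f = (\<Sum>i\<in>Idx. x_term (r i) i)" "\<forall>i. r i \<in> polys_over k"
      by (auto simp: reduced_sums_def)
    have "f * x = (\<Sum>i\<in>Idx. x_term (pCons 0 (r i)) (fst i, snd i))"
      unfolding r(1) x_term_def sum_distrib_right by (intro sum.cong) (simp_all add: mult_ac)
    also have "\<dots> \<in> R.N" using r
      by (intro R.reduced_sum R.reduced_term) (auto simp: kring is_subringD[OF kring])
    finally show ?case .
  next
    case (mult_y f)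
    then obtain r where r: "f = (\<Sum>i\<in>Idx. x_term (r i) i)" "\<forall>i. r i \<in> polys_over k"
      by (auto simp: reduced_sums_def)
    have "f * y = (\<Sum>i\<in>Idx. x_term (r i) (Suc (fst i), snd i))"
      unfolding r(1) x_term_def sum_distrib_right by (intro sum.cong) (simp_all add: mult_ac)
    also have "\<dots> \<in> R.N" using r by (intro R.reduced_sum R.reduced_term) auto
    finally show ?case .
  next
    case (mult_z f)
    then obtain r where r: "f = (\<Sum>i\<in>Idx. x_term (r i) i)" "\<forall>i. r i \<in> polys_over k"
      by (auto simp: reduced_sums_def)
    have "f * z = (\<Sum>i\<in>Idx. x_term (r i) (fst i, Suc (snd i)))"
      unfolding r(1) x_term_def sum_distrib_right by (intro sum.cong) (simp_all add: mult_ac)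
    also have "\<dots> \<in> R.N" using r by (intro R.reduced_sum R.reduced_term) auto
    finally show ?case .
  qed (rule R.reduced_add)
  thus ?thesis using that by (auto simp: reduced_sums_def x_sum_def)
qed

section \<open>Places that separate the terms\<close>

text \<open>
  A weight predicts the value of every term \<open>r(x) y^b z^d\<close>; it is separating if terms with different
  exponents \<open>(b, d)\<close> never have equal values, whatever their coefficients are.
\<close>
definition weighs :: "('f \<Rightarrow> int) \<Rightarrow> ('f poly \<Rightarrow> nat \<times> nat \<Rightarrow> int) \<Rightarrow> bool" where
  "weighs v w \<longleftrightarrow> (\<forall>r\<in>polys_over k. r \<noteq> 0 \<longrightarrow>
     (\<forall>i. x_term r i \<noteq> 0 \<and> v (x_term r i) = w r i))"

lemma weighsD:
  assumes "weighs v w" "r \<in> polys_over k" "r \<noteq> 0"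
  shows "x_term r i \<noteq> 0" "v (x_term r i) = w r i"
  using assms unfolding weighs_def by blast+

definition separating :: "('f poly \<Rightarrow> nat \<times> nat \<Rightarrow> int) \<Rightarrow> bool" where
  "separating w \<longleftrightarrow> (\<forall>r s. \<forall>i\<in>Idx. \<forall>j\<in>Idx. w r i = w s j \<longrightarrow> i = j)"

lemma weighs_x_sum:
  assumes v: "v \<in> places k" and w: "weighs v w" "separating w" and r: "\<And>i. r i \<in> polys_over k"
    and nz: "\<exists>i\<in>Idx. r i \<noteq> 0"
  shows "x_sum r \<noteq> 0" "\<exists>i\<in>Idx. r i \<noteq> 0 \<and> v (x_sum r) = w (r i) i"
    "\<And>i. i \<in> Idx \<Longrightarrow> r i \<noteq> 0 \<Longrightarrow> v (x_sum r) \<le> w (r i) i"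
proof -
  have t: "x_term (r i) i \<noteq> 0 \<longleftrightarrow> r i \<noteq> 0" "r i \<noteq> 0 \<Longrightarrow> v (x_term (r i) i) = w (r i) i" for i
  proof -
    have "x_term 0 i = 0" by (simp add: x_term_def)
    thus "x_term (r i) i \<noteq> 0 \<longleftrightarrow> r i \<noteq> 0" using weighsD(1)[OF w(1) r] by metis
    show "r i \<noteq> 0 \<Longrightarrow> v (x_term (r i) i) = w (r i) i" by (rule weighsD(2)[OF w(1) r])
  qed
  have "x_sum r \<noteq> 0 \<and> (\<exists>i\<in>Idx. x_term (r i) i \<noteq> 0 \<and> v (x_sum r) = v (x_term (r i) i)) \<and>
          (\<forall>i\<in>Idx. x_term (r i) i \<noteq> 0 \<longrightarrow> v (x_sum r) \<le> v (x_term (r i) i))"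
    unfolding x_sum_def
  proof (rule val_sum_separated[OF placeD(1)[OF v]])
    fix i j assume "i \<in> Idx" "j \<in> Idx" "x_term (r i) i \<noteq> 0" "x_term (r j) j \<noteq> 0" "i \<noteq> j"
    thus "v (x_term (r i) i) \<noteq> v (x_term (r j) j)"
      using w(2) t unfolding separating_def by metis
  qed (use nz t in auto)
  thus "x_sum r \<noteq> 0" "\<exists>i\<in>Idx. r i \<noteq> 0 \<and> v (x_sum r) = w (r i) i"
    "\<And>i. i \<in> Idx \<Longrightarrow> r i \<noteq> 0 \<Longrightarrow> v (x_sum r) \<le> w (r i) i"
    using t by metis+
qed

lemma x_sum_nonzero_iff:
  assumes "x_sum r \<noteq> 0" shows "\<exists>i\<in>Idx. r i \<noteq> 0"
proof (rule ccontr)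
  assume "\<not> ?thesis"
  hence "x_sum r = 0" unfolding x_sum_def x_term_def by (intro sum.neutral) auto
  thus False using assms by simp
qed

text \<open>The values on \<open>A\<close> are minima of weights of terms, hence the same for both places.\<close>
lemma weighs_unique:
  assumes "v \<in> places k" "v' \<in> places k" "weighs v w" "weighs v' w" "separating w"
  shows "v = v'"
proof (rule places_eqI[OF assms(1,2)])
  fix a assume a: "a \<in> A" "a \<noteq> 0"
  obtain r where r: "\<And>i. r i \<in> polys_over k" "a = x_sum r" using A_eq_x_sum[OF a(1)] by blast
  have nz: "\<exists>i\<in>Idx. r i \<noteq> 0" using x_sum_nonzero_iff a r by simp
  note 1 = weighs_x_sum[OF assms(1,3,5) r(1) nz] and 2 = weighs_x_sum[OF assms(2,4,5) r(1) nz]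
  from 1(2) 2(3) have "v' a \<le> v a" unfolding r by force
  moreover from 2(2) 1(3) have "v a \<le> v' a" unfolding r by force
  ultimately show "v a = v' a" by simp
qed

text \<open>
  A common factor of the weights of all terms divides every value on \<open>A\<close> and on its field of
  fractions, but a place takes the value \<open>1\<close>.  This shows that the place is totally ramified over
  the \<open>x\<close>-line, without computing the degree of the field extension.
\<close>
lemma weighs_scale_1:
  assumes v: "v \<in> places k" and w: "weighs v (\<lambda>r i. b * w r i)" "separating w" and b: "b > 0"
  shows "b = 1"
proof -
  have sep: "separating (\<lambda>r i. b * w r i)" using w(2) b by (simp add: separating_def)
  have dvd: "b dvd v a" if a: "a \<in> A" for a
  proof (cases "a = 0")
    case False
    obtain r where r: "\<And>i. r i \<in> polys_over k" "a = x_sum r" using A_eq_x_sum[OF a(1)] by blast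
    have nz: "\<exists>i\<in>Idx. r i \<noteq> 0" using x_sum_nonzero_iff False r by simp
    from weighs_x_sum(2)[OF v w(1) sep r(1) nz] show ?thesis by (auto simp: r)
  qed (simp add: placeD[OF v])
  obtain t where t: "v t = 1" using placeD(4)[OF v] by blast
  obtain a c where *: "a \<in> A" "c \<in> A" "c \<noteq> 0" "t = a / c" by (rule fraction)
  have "a \<noteq> 0" using t * placeD[OF v] by auto
  hence "v t = v a - v c" using * by (simp add: val_divide[OF placeD(1)[OF v]])
  hence "b dvd 1" using t dvd[OF *(1)] dvd[OF *(2)] by (metis dvd_diff)
  thus ?thesis using b by simp
qed

definition wt_inf :: "'f poly \<Rightarrow> nat \<times> nat \<Rightarrow> int" where
  "wt_inf r i = - (E * int (degree r) + int q * int M * int (fst i) + int q ^ 3 * int (snd i))"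

definition wt_at :: "'f \<Rightarrow> 'f poly \<Rightarrow> nat \<times> nat \<Rightarrow> int" where
  "wt_at a r i = E * int (order a r) + int M * int (fst i) + int (snd i)"

lemma eq_if_dvd_diff:
  fixes m a b :: nat
  assumes "int m dvd int a - int b" "a < m" "b < m"
  shows "a = b"
proof -
  have "int a mod int m = int b mod int m" using assms(1) by (simp add: mod_eq_dvd_iff)
  thus ?thesis using assms by simp
qed

text \<open>
  The weight is \<open>E n + M b + d\<close>: its residue modulo \<open>M\<close> determines \<open>d < M\<close>, and then its residue
  modulo \<open>E\<close> determines \<open>b \<le> q\<close>.
\<close>
lemma separating_wt_at: "separating (wt_at a)"
  unfolding separating_def
proof (intro allI ballI impI)
  fix r s i j assume ij: "i \<in> Idx" "j \<in> Idx" and eq: "wt_at a r i = wt_at a s j"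
  define D where "D = int (order a s) - int (order a r)"
  have eq': "int (snd i) - int (snd j) = int M * ((int q + 1) * D + int (fst j) - int (fst i))"
    using eq by (simp add: wt_at_def D_def algebra_simps)
  hence s: "snd i = snd j" using ij by (intro eq_if_dvd_diff[of M]) auto
  hence "int (fst i) - int (fst j) = (int q + 1) * D" using eq' M_pos by auto
  hence "int (q + 1) dvd int (fst i) - int (fst j)" by (metis dvd_triv_left int_plus of_nat_1)
  hence "fst i = fst j" using ij by (intro eq_if_dvd_diff[of "q + 1"]) auto
  with s show "i = j" by (simp add: prod_eq_iff)
qed

text \<open>
  The same argument, where now \<open>d\<close> is multiplied by \<open>q^3\<close> and \<open>b\<close> by \<open>q M\<close>; both remain determined
  because \<open>q\<close> is prime to \<open>M\<close> and to \<open>q + 1\<close>.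
\<close>
lemma separating_wt_inf: "separating wt_inf"
  unfolding separating_def
proof (intro allI ballI impI)
  fix r s i j assume ij: "i \<in> Idx" "j \<in> Idx" and eq: "wt_inf r i = wt_inf s j"
  define D where "D = int (degree s) - int (degree r)"
  have eq': "int q ^ 3 * (int (snd i) - int (snd j)) =
      int M * ((int q + 1) * D + int q * (int (fst j) - int (fst i)))"
    using eq by (simp add: wt_inf_def D_def algebra_simps)
  hence "int M dvd int q ^ 3 * (int (snd i) - int (snd j))" by simp
  moreover have "coprime (int M) (int q ^ 3)" using coprime_M_q by simp
  ultimately have "int M dvd int (snd i) - int (snd j)" by (simp add: coprime_dvd_mult_right_iff)
  hence s: "snd i = snd j" using ij by (intro eq_if_dvd_diff[of M]) auto
  hence "(int q + 1) * D + int q * (int (fst j) - int (fst i)) = 0" using eq' M_pos by simp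
  hence "int q * (int (fst i) - int (fst j)) = (int q + 1) * D" by (simp add: algebra_simps)
  hence "int (q + 1) dvd int q * (int (fst i) - int (fst j))" by (metis dvd_triv_left int_plus of_nat_1)
  moreover have "coprime (int (q + 1)) (int q)" by (simp add: coprime_iff_gcd_eq_1)
  ultimately have "int (q + 1) dvd int (fst i) - int (fst j)" by (simp add: coprime_dvd_mult_right_iff)
  hence "fst i = fst j" using ij by (intro eq_if_dvd_diff[of "q + 1"]) auto
  with s show "i = j" by (simp add: prod_eq_iff)
qed

section \<open>The places over infinity and over the roots\<close>

text \<open>
  At a pole the highest powers dominate, so \<open>q v(x) = (q + 1) v(y)\<close> and \<open>q^2 v(y) = M v(z)\<close>.  The
  coprimality of \<open>q\<close> with \<open>q + 1\<close> and \<open>M\<close> leaves one common factor \<open>b\<close>.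
\<close>
lemma pole_of_x:
  assumes v: "v \<in> places k" and neg: "v x < 0"
  obtains b where "b > 0" "v x = - E * b" "v y = - (int q * int M * b)" "v z = - (int q ^ 3 * b)"
    "y \<noteq> 0" "z \<noteq> 0"
proof -
  note V = placeD(1)[OF v]
  have x0: "x \<noteq> 0" using neg placeD(2)[OF v] by auto
  have "int q * v x < 1 * v x" using neg q_ge_2 by (intro mult_strict_right_mono_neg) auto
  hence "v (x ^ q) < v x" using x0 by (simp add: val_power[OF V])
  from val_add_eq[OF V _ x0 this] x0
  have 1: "y ^ (q + 1) \<noteq> 0" "v (y ^ (q + 1)) = int q * v x"
    unfolding eq_xy[symmetric] by (auto simp: val_power[OF V])
  hence y0: "y \<noteq> 0" by auto
  have e1: "(int q + 1) * v y = int q * v x"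
    using 1(2) unfolding val_power[OF V y0] by (simp add: algebra_simps)
  have "int q * v x < 0" using neg q_ge_2 by (simp add: mult_pos_neg)
  hence "(int q + 1) * v y < 0" unfolding e1 .
  hence vy: "v y < 0" by (simp add: mult_less_0_iff)
  have "int (q\<^sup>2) * v y < 1 * v y"
    using vy q_ge_2 power_strict_mono[of 1 q 2] by (intro mult_strict_right_mono_neg) (auto simp: )
  hence "v (y ^ (q\<^sup>2)) < v (- y)" using y0 by (simp add: val_power[OF V] val_minus[OF V])
  from val_add_eq[OF V _ _ this] y0
  have 2: "z ^ M \<noteq> 0" "v (z ^ M) = int (q\<^sup>2) * v y"
    by (auto simp: eq_yz[symmetric] val_power[OF V])
  hence z0: "z \<noteq> 0" using M_pos by (auto simp: power_0_left)
  have e2: "int M * v z = int q ^ 2 * v y" using 2(2) z0 by (simp add: val_power[OF V])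
  have "int M dvd int q ^ 2 * v y" using e2 by (metis dvd_triv_left)
  hence dM: "int M dvd v y" using coprime_M_q by (simp add: coprime_dvd_mult_right_iff)
  have "int q dvd (int q + 1) * v y" using e1 by simp
  moreover have "coprime (int q) (int q + 1)" by (simp add: coprime_iff_gcd_eq_1)
  ultimately have "int q dvd v y" by (simp add: coprime_dvd_mult_right_iff)
  moreover have "coprime (int q) (int M)" using coprime_M_q by (simp add: coprime_commute)
  ultimately have "int q * int M dvd v y" using dM by (intro divides_mult)
  then obtain c where c: "v y = int q * int M * c" by (elim dvdE)
  have qp: "int q > 0" "int M > 0" using q_ge_2 M_pos by auto
  have "c < 0" using vy qp unfolding c by (simp add: mult_less_0_iff zero_less_mult_iff)
  moreover have "v x = E * c"
  proof -
    have "int q * v x = int q * (E * c)" unfolding e1[symmetric] c by (simp add: algebra_simps)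
    thus ?thesis using qp by simp
  qed
  moreover have "v z = int q ^ 3 * c"
  proof -
    have "int M * v z = int M * (int q ^ 3 * c)"
      using e2 unfolding c by (simp add: power2_eq_square power3_eq_cube mult_ac)
    thus ?thesis using qp by simp
  qed
  ultimately show ?thesis using that[of "-c"] y0 z0 c by simp
qed

text \<open>At a pole of \<open>t\<close> the leading term of a polynomial in \<open>t\<close> dominates.\<close>
lemma val_poly_pole:
  assumes v: "v \<in> places k" and neg: "v t < 0" and r: "r \<in> polys_over k" "r \<noteq> 0"
  shows "poly r t \<noteq> 0 \<and> v (poly r t) = int (degree r) * v t"
  using r
proof (induction r)
  case (pCons a s)
  note V = placeD(1)[OF v]
  have t0: "t \<noteq> 0" using neg placeD(2)[OF v] by auto
  have as: "a \<in> k" "s \<in> polys_over k" using pCons.prems by (auto simp: kring)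
  show ?case
  proof (cases "s = 0")
    case True
    thus ?thesis using pCons.prems as placeD(3)[OF v] by simp
  next
    case False
    with pCons.IH as have IH: "poly s t \<noteq> 0" "v (poly s t) = int (degree s) * v t" by auto
    have *: "v (t * poly s t) = int (degree s + 1) * v t" "t * poly s t \<noteq> 0"
      using IH t0 by (auto simp: val_mult[OF V] algebra_simps)
    show ?thesis
    proof (cases "a = 0")
      case True
      thus ?thesis using * False by simp
    next
      case a0: False
      have "int (degree s + 1) * v t < 0" using neg by (intro mult_pos_neg) auto
      with * as have "v (t * poly s t) < v a" by (simp add: placeD(3)[OF v])
      from val_add_eq[OF V *(2) a0 this] * False show ?thesis by (simp add: add.commute)
    qed
  qed
qed simp

lemma weighs_inf:
  assumes v: "v \<in> places k" and neg: "v x < 0"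
  shows "weighs v wt_inf"
proof -
  note V = placeD(1)[OF v]
  obtain b where b: "b > 0" "v x = - E * b" "v y = - (int q * int M * b)" "v z = - (int q ^ 3 * b)"
    "y \<noteq> 0" "z \<noteq> 0" by (rule pole_of_x[OF v neg])
  have w: "weighs v (\<lambda>r i. b * wt_inf r i)"
    unfolding weighs_def
  proof (intro ballI impI conjI allI)
    fix r i assume "r \<in> polys_over k" "r \<noteq> 0"
    from val_poly_pole[OF v neg this] have *: "poly r x \<noteq> 0" "v (poly r x) = int (degree r) * v x" by auto
    thus "x_term r i \<noteq> 0" using b by (auto simp: x_term_def)
    show "v (x_term r i) = b * wt_inf r i"
      using * b by (simp add: x_term_def val_mult[OF V] val_power[OF V] wt_inf_def algebra_simps)
  qed
  with weighs_scale_1[OF v w separating_wt_inf b(1)] show ?thesis by simp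
qed

text \<open>
  Since \<open>a^q + a = 0\<close>, the first equation reads \<open>(x - a)^q + (x - a) = y^(q+1)\<close>.  At a zero
  the lowest powers dominate, so \<open>v(x - a) = (q + 1) v(y)\<close> and \<open>v(y) = M v(z)\<close>.
\<close>
lemma zero_of_x:
  assumes v: "v \<in> places k" and a: "a \<in> k" "a ^ q + a = 0" and pos: "v (x - a) > 0"
  obtains b where "b > 0" "v (x - a) = E * b" "v y = int M * b" "v z = b" "y \<noteq> 0" "z \<noteq> 0"
proof -
  note V = placeD(1)[OF v]
  define u where "u = x - a"
  have u0: "u \<noteq> 0" using pos placeD(2)[OF v] by (auto simp: u_def)
  have "(u + a) ^ q = u ^ q + a ^ q"
    by (rule frobenius_add[OF prime_p char_p q_eq]) simp
  hence "x ^ q + x = u ^ q + u + (a ^ q + a)" by (simp add: u_def)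
  hence uq: "u + u ^ q = y ^ (q + 1)" using a eq_xy by (simp add: add.commute)
  have "1 * v u < int q * v u" using pos q_ge_2 by (intro mult_strict_right_mono) (auto simp: u_def)
  hence "v u < v (u ^ q)" using u0 by (simp add: val_power[OF V])
  from val_add_eq[OF V u0 _ this] u0 have 1: "y ^ (q + 1) \<noteq> 0" "v (y ^ (q + 1)) = v u" by (auto simp: uq)
  hence y0: "y \<noteq> 0" by auto
  have e1: "(int q + 1) * v y = v u" using 1(2) unfolding val_power[OF V y0] by (simp add: algebra_simps)
  have "(int q + 1) * v y > 0" unfolding e1 u_def by (rule pos)
  hence vy: "v y > 0" by (simp add: zero_less_mult_iff)
  have "1 * v y < int (q\<^sup>2) * v y"
    using vy q_ge_2 power_strict_mono[of 1 q 2] by (intro mult_strict_right_mono) auto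
  hence "v (- y) < v (y ^ (q\<^sup>2))" using y0 by (simp add: val_power[OF V] val_minus[OF V])
  from val_add_eq[OF V _ _ this] y0 eq_yz
  have 2: "z ^ M \<noteq> 0" "v (z ^ M) = v y" by (auto simp: val_minus[OF V])
  hence z0: "z \<noteq> 0" using M_pos by (auto simp: power_0_left)
  have e2: "int M * v z = v y" using 2(2) z0 by (simp add: val_power[OF V])
  have "v z > 0" using e2 vy M_pos by (metis zero_less_mult_iff of_nat_less_0_iff)
  moreover have "v (x - a) = E * v z" using e1 unfolding u_def e2[symmetric] by (simp add: mult_ac)
  ultimately show ?thesis using that[of "v z"] e2 y0 z0 by simp
qed

text \<open>Induction on the degree: either \<open>x - a\<close> splits off, or the constant \<open>r(a)\<close> dominates.\<close>
lemma val_poly_x_at: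
  assumes v: "v \<in> places k" and a: "a \<in> k" and pos: "v (x - a) > 0"
    and r: "r \<in> polys_over k" "r \<noteq> 0"
  shows "poly r x \<noteq> 0 \<and> v (poly r x) = int (order a r) * v (x - a)"
  using r
proof (induction "degree r" arbitrary: r rule: less_induct)
  case less
  note V = placeD(1)[OF v] and R = is_subringD[OF regular_subring[OF v], simplified]
  have u0: "x - a \<noteq> 0" using pos placeD(2)[OF v] by auto
  have reg: "regular_at v (poly s x)" if "s \<in> polys_over k" for s
  proof -
    have kR: "k \<subseteq> {h. regular_at v h}" using placeD(3)[OF v] by (auto simp: regular_at_def)
    have "regular_at v ((x - a) + a)" using pos a kR by (intro R(6)) (auto simp: regular_at_def[of v "x - a"])
    thus ?thesis using poly_polys_over_mem[OF kring regular_subring[OF v] kR _ that, of x] by simp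
  qed
  define s where "s = synthetic_div r a"
  have s: "s \<in> polys_over k" unfolding s_def by (rule synthetic_div_over[OF kring less.prems(1) a])
  have rs: "r = [:- a, 1:] * s + [:poly r a:]"
    unfolding s_def using synthetic_div_correct'[of a r] by simp
  have eq: "poly r x = poly r a + (x - a) * poly s x"
    by (subst rs) (simp add: algebra_simps)
  show ?case
  proof (cases "poly r a = 0")
    case True
    with rs have r': "r = [:- a, 1:] * s" by simp
    hence s0: "s \<noteq> 0" using less.prems by auto
    hence "degree r = Suc (degree s)" by (subst r', subst degree_mult_eq) auto
    with less.hyps[of s] s s0 have IH: "poly s x \<noteq> 0" "v (poly s x) = int (order a s) * v (x - a)" by auto
    have "order a r = Suc (order a s)"
      using s0 less.prems order_power_n_n[of a 1] by (subst r', subst order_mult) (auto simp: r')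
    moreover have "poly r x = (x - a) * poly s x" using eq True by simp
    moreover have "v ((x - a) * poly s x) = v (x - a) + v (poly s x)" using u0 IH by (intro val_mult[OF V])
    ultimately show ?thesis using IH u0 by (simp add: distrib_right)
  next
    case False
    hence o: "order a r = 0" by (simp add: order_0I)
    have "poly r a \<in> k" by (rule poly_polys_over_mem[OF kring kring order.refl a less.prems(1)])
    hence v0: "v (poly r a) = 0" by (rule placeD(3)[OF v])
    show ?thesis
    proof (cases "poly s x = 0")
      case True
      thus ?thesis using eq False o v0 by simp
    next
      case s0: False
      hence "v (poly r a) < v ((x - a) * poly s x)"
        using reg[OF s] pos u0 v0 by (auto simp: regular_at_def val_mult[OF V])
      from val_add_eq[OF V False _ this] u0 s0 show ?thesis by (simp add: eq[symmetric] o v0)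
    qed
  qed
qed

lemma weighs_at:
  assumes v: "v \<in> places k" and a: "a \<in> k" "a ^ q + a = 0" and pos: "v (x - a) > 0"
  shows "weighs v (wt_at a)"
proof -
  note V = placeD(1)[OF v]
  obtain b where b: "b > 0" "v (x - a) = E * b" "v y = int M * b" "v z = b" "y \<noteq> 0" "z \<noteq> 0"
    by (rule zero_of_x[OF v a pos])
  have w: "weighs v (\<lambda>r i. b * wt_at a r i)"
    unfolding weighs_def
  proof (intro ballI impI conjI allI)
    fix r i assume "r \<in> polys_over k" "r \<noteq> 0"
    from val_poly_x_at[OF v a(1) pos this]
    have *: "poly r x \<noteq> 0" "v (poly r x) = int (order a r) * v (x - a)" by auto
    thus "x_term r i \<noteq> 0" using b by (auto simp: x_term_def)
    show "v (x_term r i) = b * wt_at a r i"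
      using * b by (simp add: x_term_def val_mult[OF V] val_power[OF V] wt_at_def algebra_simps)
  qed
  with weighs_scale_1[OF v w separating_wt_at b(1)] show ?thesis by simp
qed

lemma place_with_pole_of_x:
  "v \<in> places k \<Longrightarrow> v x < 0 \<Longrightarrow> v = P_inf"
  using weighs_unique[OF _ P_inf weighs_inf weighs_inf[OF P_inf P_inf_x] separating_wt_inf] by blast

lemma place_above_root_unique:
  assumes "v \<in> places k" "v' \<in> places k" "a \<in> k" "a ^ q + a = 0" "v (x - a) > 0" "v' (x - a) > 0"
  shows "v = v'"
  using assms by (intro weighs_unique[OF _ _ weighs_at weighs_at separating_wt_at])

text \<open>The elements \<open>y\<close> and \<open>z\<close> are integral over \<open>k[x]\<close>.\<close>
lemma regular_on_A:
  assumes v: "v \<in> places k" and "v x \<ge> 0" and f: "f \<in> A"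
  shows "regular_at v f"
proof -
  note V = placeD(1)[OF v] and R = is_subringD[OF regular_subring[OF v], simplified]
  have Rp: "regular_at v (h ^ n)" if "regular_at v h" for h n
    using that by (induction n) (auto intro: R)
  have x: "regular_at v x" using assms by (simp add: regular_at_def)
  have root: "regular_at v h" if "regular_at v (h ^ n)" "n > 0" for h n
  proof (cases "h = 0")
    case False
    with that have "int n * v h \<ge> 0" by (simp add: regular_at_def val_power[OF V])
    thus ?thesis using that by (simp add: regular_at_def zero_le_mult_iff)
  qed (simp add: regular_at_def)
  have y: "regular_at v y" using root[of y "q + 1"] R(6)[OF Rp[OF x] x, of q] eq_xy by simp
  have z: "regular_at v z" using root[of z M] R(3)[OF Rp[OF y] y, of "q\<^sup>2"] eq_yz M_pos by simp
  from f show ?thesis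
  proof (induction f rule: coordinate_ring.induct)
    case (const c)
    thus ?case by (simp add: regular_at_def placeD(3)[OF v])
  qed (blast intro: R x y z)+
qed

end

section \<open>The coordinate ring as a module over the polynomials in z\<close>

context curve
begin

definition Kz :: "'f set" where "Kz = adjoin k z"

text \<open>
  \<open>A\<close> arises from \<open>k[z]\<close> by adjoining first \<open>y\<close> and then \<open>x\<close>, both algebraic, so
  \<open>algebraic_adjunction_multiple\<close> applies twice.
\<close>
lemma multiple_in_Kz:
  assumes f: "f \<in> A" "f \<noteq> 0"
  obtains a h where "a \<in> A" "h \<in> polys_over k" "h \<noteq> 0" "f * a = poly h z"
proof -
  define B where "B = adjoin Kz y"
  note Kz = adjoin[OF kring, of z, folded Kz_def]
  note B = adjoin[OF Kz(1), of y, folded B_def]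
  note C = adjoin[OF B(1), of x]
  have gens: "x \<in> adjoin B x" "y \<in> adjoin B x" "z \<in> adjoin B x"
    using C(2,3) B(2,3) Kz(3) by auto
  have "f \<in> adjoin B x" using f(1)
  proof (induction f rule: coordinate_ring.induct)
    case (const c)
    thus ?case using Kz(2) B(2) C(2) by auto
  qed (simp_all add: is_subringD(4,6)[OF C(1)] gens)
  then obtain P where P: "P \<in> polys_over B" "f = poly P x" by (auto simp: adjoin_def)
  have KzA: "Kz \<subseteq> A" unfolding Kz_def adjoin_def using A_poly xyz_in_A by auto
  have BA: "B \<subseteq> A"
    unfolding B_def adjoin_def using poly_polys_over_mem[OF Kz(1) A_subring KzA xyz_in_A(2)] by auto
  have powB: "y ^ n \<in> B" for n by (induction n) (auto intro: is_subringD[OF B(1)] B(3))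
  have powK: "z ^ n \<in> Kz" for n by (induction n) (auto intro: is_subringD[OF Kz(1)] Kz(3))
  define mx where "mx = monom 1 q + monom 1 1 - [:y ^ (q + 1):]"
  have mx: "mx \<in> polys_over B" "poly mx x = 0"
    unfolding mx_def using powB B(1) is_subringD(2)[OF B(1)] eq_xy
    by (auto simp: poly_monom simp del: power_Suc intro!: polys_over_diff polys_over_add polys_over_monom)
  have "coeff mx q = 1" using q_ge_2 by (simp add: mx_def coeff_pCons split: nat.split)
  hence mx0: "mx \<noteq> 0" by auto
  define my where "my = monom 1 (q\<^sup>2) - monom 1 1 - [:z ^ M:]"
  have my: "my \<in> polys_over Kz" "poly my y = 0"
    unfolding my_def using powK Kz(1) is_subringD(2)[OF Kz(1)] eq_yz
    by (auto simp: poly_monom intro!: polys_over_diff polys_over_add polys_over_monom)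
  have "q\<^sup>2 > 1" using q_ge_2 power_strict_mono[of 1 q 2] by simp
  hence "coeff my (q\<^sup>2) = 1" using q_ge_2 by (simp add: my_def coeff_pCons split: nat.split)
  hence my0: "my \<noteq> 0" by auto
  obtain Q where Q: "Q \<in> polys_over B" "f * poly Q x \<in> B" "f * poly Q x \<noteq> 0"
    using algebraic_adjunction_multiple[OF B(1) mx(1) mx0 mx(2) P(1)] f(2) P(2) by metis
  then obtain P' where P': "P' \<in> polys_over Kz" "f * poly Q x = poly P' y"
    by (auto simp: B_def adjoin_def)
  obtain Q' where Q': "Q' \<in> polys_over Kz" "poly P' y * poly Q' y \<in> Kz" "poly P' y * poly Q' y \<noteq> 0"
    using algebraic_adjunction_multiple[OF Kz(1) my(1) my0 my(2) P'(1)] Q(3) P'(2) by metis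
  then obtain h where h: "h \<in> polys_over k" "poly P' y * poly Q' y = poly h z"
    by (auto simp: Kz_def adjoin_def)
  have "poly Q x \<in> A" by (rule poly_polys_over_mem[OF B(1) A_subring BA xyz_in_A(1) Q(1)])
  moreover have "poly Q' y \<in> A" by (rule poly_polys_over_mem[OF Kz(1) A_subring KzA xyz_in_A(2) Q'(1)])
  ultimately have "poly Q x * poly Q' y \<in> A" by (rule is_subringD(4)[OF A_subring])
  moreover have "f * (poly Q x * poly Q' y) = poly h z"
    unfolding h(2)[symmetric] P'(2)[symmetric] by (simp add: mult_ac)
  moreover have "h \<noteq> 0" using Q'(3) h(2) by auto
  ultimately show ?thesis using that h(1) by blast
qed

text \<open>
  Compared with \<open>x_term\<close> the roles of \<open>x\<close> and \<open>z\<close> are exchanged: \<open>A\<close> is also free over \<open>k[z]\<close>, with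
  the basis \<open>y^i x^j\<close> for \<open>i < q^2\<close> and \<open>j < q\<close>.
\<close>
definition z_term :: "'f poly \<Rightarrow> nat \<times> nat \<Rightarrow> 'f" where
  "z_term r i = poly r z * y ^ fst i * x ^ snd i"

abbreviation Jdx :: "(nat \<times> nat) set" where "Jdx \<equiv> {..<q\<^sup>2} \<times> {..<q}"

lemma P_inf_z: "P_inf z < 0"
  using pole_of_x[OF P_inf P_inf_x] q_ge_2 by (metis neg_less_0_iff_less zero_less_mult_iff
      zero_less_power of_nat_0_less_iff less_le_trans zero_less_numeral)

lemma poly_z_nonzero: "r \<in> polys_over k \<Longrightarrow> r \<noteq> 0 \<Longrightarrow> poly r z \<noteq> 0"
  using val_poly_pole[OF P_inf P_inf_z] by blast

text \<open>
  At \<open>P_inf\<close> the pole order of a term is a positive multiple of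
  \<open>q^3 deg g + q M i + (q + 1) M j\<close>.  Modulo \<open>q\<close> this determines \<open>j\<close>, then modulo \<open>q^3\<close> it determines
  \<open>i\<close>; so the terms have different values and cannot cancel.
\<close>
lemma z_terms_independent:
  assumes g: "\<And>i. g i \<in> polys_over k" and zero: "(\<Sum>i\<in>Jdx. z_term (g i) i) = 0" and i: "i \<in> Jdx"
  shows "g i = 0"
proof (rule ccontr)
  assume gi: "g i \<noteq> 0"
  note V = placeD(1)[OF P_inf]
  obtain b where b: "b > 0" "P_inf x = - E * b" "P_inf y = - (int q * int M * b)"
    "P_inf z = - (int q ^ 3 * b)" "y \<noteq> 0" "z \<noteq> 0" by (rule pole_of_x[OF P_inf P_inf_x])
  have x0: "x \<noteq> 0" using P_inf_x placeD(2)[OF P_inf] by auto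
  have nz: "z_term (g j) j \<noteq> 0 \<longleftrightarrow> g j \<noteq> 0" for j
    using poly_z_nonzero[OF g[of j]] x0 b by (auto simp: z_term_def)
  have val: "P_inf (z_term (g j) j) = - b * (int q ^ 3 * int (degree (g j)) + int q * int M * int (fst j)
      + (int q + 1) * int M * int (snd j))" if "g j \<noteq> 0" for j
  proof -
    have "P_inf (z_term (g j) j) =
        int (degree (g j)) * P_inf z + int (fst j) * P_inf y + int (snd j) * P_inf x"
      using val_poly_pole[OF P_inf P_inf_z g that] x0 b(5,6)
      by (simp add: z_term_def val_mult[OF V] val_power[OF V])
    thus ?thesis unfolding b(2-4) by (simp add: algebra_simps)
  qed
  have "(\<Sum>i\<in>Jdx. z_term (g i) i) \<noteq> 0"
  proof (rule conjunct1[OF val_sum_separated[OF V]])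
    fix i j assume ij: "i \<in> Jdx" "j \<in> Jdx" "z_term (g i) i \<noteq> 0" "z_term (g j) j \<noteq> 0" "i \<noteq> j"
    show "P_inf (z_term (g i) i) \<noteq> P_inf (z_term (g j) j)"
    proof
      assume eq: "P_inf (z_term (g i) i) = P_inf (z_term (g j) j)"
      define D where "D = int (degree (g j)) - int (degree (g i))"
      have "int q ^ 3 * int (degree (g i)) + int q * int M * int (fst i) + (int q + 1) * int M * int (snd i)
         = int q ^ 3 * int (degree (g j)) + int q * int M * int (fst j) + (int q + 1) * int M * int (snd j)"
        using eq ij nz val b(1) by simp
      hence eq': "(int (q + 1) * int M) * (int (snd i) - int (snd j)) =
          int q * (int q ^ 2 * D + int M * (int (fst j) - int (fst i)))"
        by (simp add: D_def algebra_simps power3_eq_cube power2_eq_square)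
      have cop: "coprime (int q) (int M)" using coprime_M_q by (simp add: coprime_commute)
      moreover have "coprime (int q) (int (q + 1))" by (subst coprime_int_iff) (simp del: of_nat_add of_nat_Suc)
      ultimately have "coprime (int q) (int (q + 1) * int M)" by simp
      moreover have "int q dvd (int (q + 1) * int M) * (int (snd i) - int (snd j))"
        unfolding eq' by simp
      ultimately have "int q dvd int (snd i) - int (snd j)" by (simp only: coprime_dvd_mult_right_iff)
      hence s: "snd i = snd j" using ij by (intro eq_if_dvd_diff[of q]) auto
      hence "int q ^ 2 * D + int M * (int (fst j) - int (fst i)) = 0" using eq' q_ge_2 by simp
      hence "int M * (int (fst i) - int (fst j)) = int (q\<^sup>2) * D" by (simp add: algebra_simps)
      hence "int (q\<^sup>2) dvd int M * (int (fst i) - int (fst j))" by simp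
      moreover have "coprime (int (q\<^sup>2)) (int M)" using cop by simp
      ultimately have "int (q\<^sup>2) dvd int (fst i) - int (fst j)"
        by (simp only: coprime_dvd_mult_right_iff)
      hence "fst i = fst j" using ij by (intro eq_if_dvd_diff[of "q\<^sup>2"]) auto
      with s ij show False by (simp add: prod_eq_iff)
    qed
  qed (use i gi nz in auto)
  with zero show False by simp
qed

end

section \<open>Power series branches at the affine points\<close>

definition to_fps :: "'f::field \<Rightarrow> 'f alg_closure fps" where
  "to_fps a = fps_const (to_ac a)"

lemma to_fps_simps [simp]:
  "to_fps 0 = 0" "to_fps 1 = 1" "to_fps (a + b) = to_fps a + to_fps b"
  "to_fps (a * b) = to_fps a * to_fps b" "to_fps (- a) = - to_fps a" "to_fps a = 0 \<longleftrightarrow> a = 0"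
  by (simp_all add: to_fps_def fps_const_add[symmetric] del: fps_const_add)

text \<open>The expansion of \<open>r(c + t)\<close> as a power series in \<open>t\<close>.\<close>
definition taylor :: "'f::field alg_closure \<Rightarrow> 'f poly \<Rightarrow> 'f alg_closure fps" where
  "taylor c r = fps_of_poly (pcompose (map_poly to_ac r) [:c, 1:])"

lemma taylor_simps [simp]:
  "taylor c 0 = 0"
  "taylor c (pCons a r) = to_fps a + (fps_const c + fps_X) * taylor c r"
  "taylor c (r + s) = taylor c r + taylor c s"
  "taylor c (- r) = - taylor c r"
  "taylor c r = 0 \<longleftrightarrow> r = 0"
  "taylor c r $ 0 = poly (map_poly to_ac r) c"
proof -
  have add: "map_poly to_ac (r + s) = map_poly to_ac r + map_poly to_ac s"
    and minus: "map_poly to_ac (- r) = - map_poly to_ac r"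
    by (rule poly_eqI; simp add: coeff_map_poly)+
  show "taylor c 0 = 0" by (simp add: taylor_def)
  have Xt: "fps_of_poly [:c, 1:] = fps_const c + fps_X" by (simp add: fps_of_poly_pCons)
  show "taylor c (pCons a r) = to_fps a + (fps_const c + fps_X) * taylor c r"
    unfolding taylor_def map_poly_pCons[of to_ac, OF to_ac_0] pcompose_pCons fps_of_poly_add fps_of_poly_mult Xt
    by (simp add: to_fps_def fps_of_poly_const)
  show "taylor c (r + s) = taylor c r + taylor c s"
    by (simp add: taylor_def add pcompose_add fps_of_poly_add)
  show "taylor c (- r) = - taylor c r"
    by (simp add: taylor_def minus pcompose_uminus fps_of_poly_uminus)
  have "taylor c r = 0 \<longleftrightarrow> pcompose (map_poly to_ac r) [:c, 1:] = 0"
    by (simp add: taylor_def)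
  also have "\<dots> \<longleftrightarrow> map_poly to_ac r = 0"
    by (auto dest: pcompose_eq_0)
  also have "\<dots> \<longleftrightarrow> r = 0" by (intro map_poly_eq_0_iff) auto
  finally show "taylor c r = 0 \<longleftrightarrow> r = 0" .
  show "taylor c r $ 0 = poly (map_poly to_ac r) c"
    by (simp add: taylor_def poly_0_coeff_0[symmetric] poly_pcompose)
qed

text \<open>
  The homomorphism from \<open>k[x, y, z]\<close> to power series with \<open>x \<mapsto> Xt\<close>, \<open>y \<mapsto> Yt\<close>, \<open>z \<mapsto> Zt\<close>.  The
  elements of the field are not given as polynomials, so it is introduced as a relation that is
  proved functional afterwards.
\<close>
inductive branch_graph :: "'f::field set \<Rightarrow> 'f \<Rightarrow> 'f \<Rightarrow> 'f \<Rightarrow> 'f alg_closure fps \<Rightarrow> 'f alg_closure fps \<Rightarrow>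
    'f alg_closure fps \<Rightarrow> 'f \<Rightarrow> 'f alg_closure fps \<Rightarrow> bool"
  for k x y z Xt Yt Zt where
  const: "a \<in> k \<Longrightarrow> branch_graph k x y z Xt Yt Zt a (to_fps a)"
| add: "branch_graph k x y z Xt Yt Zt f l \<Longrightarrow> branch_graph k x y z Xt Yt Zt g l' \<Longrightarrow>
        branch_graph k x y z Xt Yt Zt (f + g) (l + l')"
| mult_x: "branch_graph k x y z Xt Yt Zt f l \<Longrightarrow> branch_graph k x y z Xt Yt Zt (f * x) (l * Xt)"
| mult_y: "branch_graph k x y z Xt Yt Zt f l \<Longrightarrow> branch_graph k x y z Xt Yt Zt (f * y) (l * Yt)"
| mult_z: "branch_graph k x y z Xt Yt Zt f l \<Longrightarrow> branch_graph k x y z Xt Yt Zt (f * z) (l * Zt)"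

text \<open>A parametrisation of the curve near a point over \<open>z = c\<close>, with \<open>z - c\<close> as the parameter.\<close>
locale curve_branch = curve p e q M k x y z P_inf
  for p e q M :: nat and k :: "'f::field set" and x y z :: 'f and P_inf :: "'f \<Rightarrow> int" +
  fixes Xt Yt Zt :: "'f alg_closure fps" and c :: "'f alg_closure"
  assumes Zt: "Zt = fps_const c + fps_X"
    and eq_XY: "Xt ^ q + Xt = Yt ^ (q + 1)" and eq_YZ: "Yt ^ (q\<^sup>2) - Yt = Zt ^ M"
begin

abbreviation "G \<equiv> branch_graph k x y z Xt Yt Zt"

lemma G_mult:
  assumes "G f l" "G g l'" shows "G (f * g) (l * l')"
  using assms(2)
proof (induction rule: branch_graph.induct)
  case (const a)
  from assms(1) have "G (a * f) (to_fps a * l)"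
  proof (induction rule: branch_graph.induct)
    case (const b)
    thus ?case using branch_graph.const[of "a * b" k x y z Xt Yt Zt] \<open>a \<in> k\<close> is_subringD(4)[OF kring] by simp
  qed (auto simp: distrib_left mult.assoc[symmetric] intro: branch_graph.intros)
  thus ?case by (simp add: mult.commute)
qed (auto simp: distrib_left mult.assoc[symmetric] intro: branch_graph.intros)

lemma G_const: "a \<in> k \<Longrightarrow> G a (to_fps a)" by (rule branch_graph.const)

lemma G_1: "G 1 1" using G_const[of 1] is_subringD[OF kring] by simp
lemma G_0: "G 0 0" using G_const[of 0] is_subringD[OF kring] by simp

lemma G_xyz: "G x Xt" "G y Yt" "G z Zt"
  using branch_graph.mult_x[OF G_1] branch_graph.mult_y[OF G_1] branch_graph.mult_z[OF G_1] by simp_all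

lemma G_minus: "G f l \<Longrightarrow> G (- f) (- l)"
  using G_mult[OF G_const[of "-1"], of f l] is_subringD[OF kring] by simp

lemma G_diff: "G f l \<Longrightarrow> G g l' \<Longrightarrow> G (f - g) (l - l')"
  using branch_graph.add[of k x y z Xt Yt Zt f l "- g" "- l'"] G_minus[of g l'] by simp

lemma G_power: "G f l \<Longrightarrow> G (f ^ n) (l ^ n)"
  by (induction n) (auto intro: G_1 G_mult)

lemma G_sum: "(\<And>i. i \<in> I \<Longrightarrow> G (f i) (l i)) \<Longrightarrow> G (sum f I) (sum l I)"
  by (induction I rule: infinite_finite_induct) (auto intro: G_0 branch_graph.add)

lemma G_poly: "r \<in> polys_over k \<Longrightarrow> G (poly r z) (taylor c r)"
proof (induction r)
  case (pCons a r)
  hence "G a (to_fps a)" "G (poly r z) (taylor c r)" by (auto simp: kring intro: G_const)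
  from branch_graph.add[OF this(1) branch_graph.mult_z[OF this(2)]]
  show ?case by (simp add: Zt mult.commute)
qed (simp add: G_0)

lemma A_iff_G: "f \<in> A \<longleftrightarrow> (\<exists>l. G f l)"
proof
  show "\<exists>l. G f l" if "f \<in> A"
    using that by (induction rule: coordinate_ring.induct) (blast intro: branch_graph.intros)+
  show "f \<in> A" if "\<exists>l. G f l"
  proof -
    from that obtain l where "G f l" by blast
    thus ?thesis by (induction rule: branch_graph.induct) (auto intro: coordinate_ring.intros)
  qed
qed

definition Z_term :: "'f poly \<Rightarrow> nat \<times> nat \<Rightarrow> 'f alg_closure fps" where
  "Z_term r i = taylor c r * Yt ^ fst i * Xt ^ snd i"

lemma G_z_term: "r \<in> polys_over k \<Longrightarrow> G (z_term r i) (Z_term r i)"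
  unfolding z_term_def Z_term_def by (intro G_mult G_poly G_power G_xyz)

lemma taylor_monom_mult: "taylor c (monom 1 n * r) = Zt ^ n * taylor c r"
proof (induction n)
  case (Suc n)
  have "monom 1 (Suc n) * r = pCons 0 (monom 1 n * r)" by (simp add: monom_Suc)
  thus ?case using Suc by (simp add: Zt mult_ac)
qed (simp add: monom_0 one_pCons[symmetric])

text \<open>
  The equations of the curve hold for \<open>x, y, z\<close> and for \<open>Xt, Yt, Zt\<close>.  Hence the reduction to the
  basis \<open>y^i x^j\<close> can be done simultaneously for an element and its series.
\<close>
lemma G_normal_form:
  assumes "G f l"
  obtains g where "\<And>i. g i \<in> polys_over k" "f = (\<Sum>i\<in>Jdx. z_term (g i) i)" "l = (\<Sum>i\<in>Jdx. Z_term (g i) i)"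
proof -
  define T where "T = (\<lambda>r i. (z_term r i, Z_term r i))"
  interpret R: monomial_reduction T "polys_over k" "q\<^sup>2" q
  proof
    fix s b d assume s: "s \<in> polys_over k" and "q\<^sup>2 \<le> b"
    define b' where "b' = b - q\<^sup>2"
    have b: "b = b' + q\<^sup>2" using \<open>q\<^sup>2 \<le> b\<close> by (simp add: b'_def)
    have yb: "y ^ b = y ^ b' * (y + z ^ M)" "Yt ^ b = Yt ^ b' * (Yt + Zt ^ M)"
      unfolding b power_add eq_yz[symmetric] eq_YZ[symmetric] by simp_all
    have "T s (b, d) = T s (b' + 1, d) + T (monom 1 M * s) (b', d)"
      unfolding T_def z_term_def Z_term_def fst_conv snd_conv yb taylor_monom_mult
      by (simp add: poly_monom algebra_simps)
    moreover have "monom 1 M * s \<in> polys_over k"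
      using s by (intro polys_over_mult polys_over_monom kring is_subringD(2)[OF kring])
    moreover have "1 < q\<^sup>2" using q_ge_2 power_strict_mono[of 1 q 2] by simp
    hence "b' + 1 < b" "b' < b" using b q_ge_2 by auto
    ultimately show "\<exists>r1\<in>polys_over k. \<exists>r2\<in>polys_over k. \<exists>b1<b. \<exists>b2<b.
        T s (b, d) = T r1 (b1, d) + T r2 (b2, d)"
      using s by blast
  next
    fix s b d assume s: "s \<in> polys_over k" and "q \<le> d"
    define d' where "d' = d - q"
    have d: "d = d' + q" using \<open>q \<le> d\<close> by (simp add: d'_def)
    have xq: "x ^ q = y ^ (q + 1) - x" "Xt ^ q = Yt ^ (q + 1) - Xt"
      using eq_xy eq_XY by (simp_all add: eq_diff_eq)
    have xd: "x ^ d = x ^ d' * (y ^ (q + 1) - x)" "Xt ^ d = Xt ^ d' * (Yt ^ (q + 1) - Xt)"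
      unfolding d power_add xq by simp_all
    have "T s (b, d) = T s (b + (q + 1), d') + T (- s) (b, d' + 1)"
      unfolding T_def z_term_def Z_term_def fst_conv snd_conv xd by (simp add: power_add algebra_simps)
    moreover have "d' + 1 < d" "d' < d" "- s \<in> polys_over k"
      using s d q_ge_2 by (auto intro: polys_over_minus[OF kring])
    ultimately show "\<exists>r1\<in>polys_over k. \<exists>r2\<in>polys_over k. \<exists>b1 b2. \<exists>d1<d. \<exists>d2<d.
        T s (b, d) = T r1 (b1, d1) + T r2 (b2, d2)"
      using s by blast
  qed (auto simp: T_def z_term_def Z_term_def kring algebra_simps zero_prod_def intro: polys_over_add[OF kring])
  have "(f, l) \<in> R.N" using assms
  proof (induction rule: branch_graph.induct)
    case (const a)
    hence "T [:a:] (0, 0) \<in> R.N" by (intro R.reduced_term) (simp add: kring)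
    moreover have "T [:a:] (0, 0) = (a, to_fps a)" by (simp add: T_def z_term_def Z_term_def)
    ultimately show ?case by simp
  next
    case (add f l g l')
    from R.reduced_add[OF add.IH] show ?case by simp
  next
    case (mult_x f l)
    then obtain r where r: "(f, l) = (\<Sum>i\<in>Jdx. T (r i) i)" "\<forall>i. r i \<in> polys_over k"
      by (auto simp: reduced_sums_def)
    have fl: "f = (\<Sum>i\<in>Jdx. z_term (r i) i)" "l = (\<Sum>i\<in>Jdx. Z_term (r i) i)"
      using arg_cong[OF r(1), of fst] arg_cong[OF r(1), of snd] by (simp_all add: fst_sum snd_sum T_def)
    have "(f * x, l * Xt) = (\<Sum>i\<in>Jdx. T (r i) (fst i, Suc (snd i)))"
      unfolding prod_eq_iff fst_sum snd_sum fst_conv snd_conv fl sum_distrib_right T_def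
      by (simp add: z_term_def Z_term_def mult_ac)
    also have "\<dots> \<in> R.N" using r by (intro R.reduced_sum R.reduced_term) auto
    finally show ?case .
  next
    case (mult_y f l)
    then obtain r where r: "(f, l) = (\<Sum>i\<in>Jdx. T (r i) i)" "\<forall>i. r i \<in> polys_over k"
      by (auto simp: reduced_sums_def)
    have fl: "f = (\<Sum>i\<in>Jdx. z_term (r i) i)" "l = (\<Sum>i\<in>Jdx. Z_term (r i) i)"
      using arg_cong[OF r(1), of fst] arg_cong[OF r(1), of snd] by (simp_all add: fst_sum snd_sum T_def)
    have "(f * y, l * Yt) = (\<Sum>i\<in>Jdx. T (r i) (Suc (fst i), snd i))"
      unfolding prod_eq_iff fst_sum snd_sum fst_conv snd_conv fl sum_distrib_right T_def
      by (simp add: z_term_def Z_term_def mult_ac)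
    also have "\<dots> \<in> R.N" using r by (intro R.reduced_sum R.reduced_term) auto
    finally show ?case .
  next
    case (mult_z f l)
    then obtain r where r: "(f, l) = (\<Sum>i\<in>Jdx. T (r i) i)" "\<forall>i. r i \<in> polys_over k"
      by (auto simp: reduced_sums_def)
    have fl: "f = (\<Sum>i\<in>Jdx. z_term (r i) i)" "l = (\<Sum>i\<in>Jdx. Z_term (r i) i)"
      using arg_cong[OF r(1), of fst] arg_cong[OF r(1), of snd] by (simp_all add: fst_sum snd_sum T_def)
    have "(f * z, l * Zt) = (\<Sum>i\<in>Jdx. T (pCons 0 (r i)) (fst i, snd i))"
      unfolding prod_eq_iff fst_sum snd_sum fst_conv snd_conv fl sum_distrib_right T_def
      by (simp add: z_term_def Z_term_def Zt mult_ac)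
    also have "\<dots> \<in> R.N" using r
      by (intro R.reduced_sum R.reduced_term) (auto simp: kring is_subringD[OF kring])
    finally show ?case .
  qed
  then obtain r where r: "(f, l) = (\<Sum>i\<in>Jdx. T (r i) i)" "\<forall>i. r i \<in> polys_over k"
    by (auto simp: reduced_sums_def)
  have "f = (\<Sum>i\<in>Jdx. z_term (r i) i)" "l = (\<Sum>i\<in>Jdx. Z_term (r i) i)"
    using arg_cong[OF r(1), of fst] arg_cong[OF r(1), of snd] by (simp_all add: fst_sum snd_sum T_def)
  thus ?thesis using that r(2) by blast
qed

text \<open>
  A relation between \<open>x, y, z\<close> has the normal form \<open>0\<close>, by independence over \<open>k[z]\<close>, so the power
  series satisfy it as well.
\<close>
lemma G_functional:
  assumes "G f l" "G f l'" shows "l = l'"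
proof -
  have "G 0 (l - l')" using G_diff[OF assms] by simp
  then obtain g where g: "\<And>i. g i \<in> polys_over k" "0 = (\<Sum>i\<in>Jdx. z_term (g i) i)"
    "l - l' = (\<Sum>i\<in>Jdx. Z_term (g i) i)" by (rule G_normal_form) blast
  have "g i = 0" if "i \<in> Jdx" for i using z_terms_independent[OF g(1) g(2)[symmetric] that] .
  hence "l - l' = 0" unfolding g(3) by (intro sum.neutral) (auto simp: Z_term_def)
  thus ?thesis by simp
qed

text \<open>
  The homomorphism is injective: a nonzero element of the kernel would have a nonzero multiple
  \<open>h(z)\<close>, but \<open>h(c + t) \<noteq> 0\<close>.
\<close>
lemma G_nonzero:
  assumes "G f l" "f \<noteq> 0" shows "l \<noteq> 0"
proof
  assume "l = 0"
  have "f \<in> A" using assms(1) A_iff_G by blast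
  then obtain a h where ah: "a \<in> A" "h \<in> polys_over k" "h \<noteq> 0" "f * a = poly h z"
    using multiple_in_Kz assms(2) by metis
  obtain l' where "G a l'" using ah(1) A_iff_G by blast
  from G_mult[OF assms(1) this] have "G (poly h z) 0" by (simp add: \<open>l = 0\<close> ah)
  from G_functional[OF this G_poly[OF ah(2)]] ah(3) show False by simp
qed

text \<open>
  The order of vanishing along the branch, extended from \<open>A\<close> to fractions \<open>f = a / b\<close>.
\<close>
definition branch_order :: "'f \<Rightarrow> int" where
  "branch_order f = (if f = 0 then 0 else (THE n. \<exists>a b l l'. G a l \<and> G b l' \<and> b \<noteq> 0 \<and> f * b = a \<and>
     n = int (subdegree l) - int (subdegree l')))"

lemma branch_order_eq:
  assumes "G a l" "G b l'" "b \<noteq> 0" "f * b = a" "f \<noteq> 0"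
  shows "branch_order f = int (subdegree l) - int (subdegree l')"
proof -
  have "(THE n. \<exists>a b l l'. G a l \<and> G b l' \<and> b \<noteq> 0 \<and> f * b = a \<and>
     n = int (subdegree l) - int (subdegree l')) = int (subdegree l) - int (subdegree l')"
  proof (rule the_equality)
    fix n assume "\<exists>a b l l'. G a l \<and> G b l' \<and> b \<noteq> 0 \<and> f * b = a \<and>
       n = int (subdegree l) - int (subdegree l')"
    then obtain a1 b1 l1 l1' where *: "G a1 l1" "G b1 l1'" "b1 \<noteq> 0" "f * b1 = a1"
      "n = int (subdegree l1) - int (subdegree l1')" by blast
    have "a * b1 = a1 * b" using * assms by (simp add: mult_ac flip: \<open>f * b = a\<close> \<open>f * b1 = a1\<close>)
    hence "l * l1' = l1 * l'" using G_functional G_mult[OF assms(1) *(2)] G_mult[OF *(1) assms(2)] by metis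
    moreover have "l \<noteq> 0" "l' \<noteq> 0" "l1 \<noteq> 0" "l1' \<noteq> 0"
      using G_nonzero assms * by (metis mult_eq_0_iff)+
    ultimately have "subdegree l + subdegree l1' = subdegree l1 + subdegree l'"
      by (metis subdegree_mult)
    thus "n = int (subdegree l) - int (subdegree l')" using * by simp
  qed (use assms in blast)
  thus ?thesis using assms by (simp add: branch_order_def)
qed

lemma branch_order_A:
  assumes "G f l" "f \<noteq> 0" shows "branch_order f = int (subdegree l)"
  using branch_order_eq[OF assms(1) G_1 _ _ assms(2)] by simp

lemma G_fraction:
  obtains a b l l' where "G a l" "G b l'" "b \<noteq> 0" "f * b = a"
proof -
  obtain a b where *: "a \<in> A" "b \<in> A" "b \<noteq> 0" "f = a / b" by (rule fraction)
  hence "f * b = a" by simp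
  with * that show ?thesis using A_iff_G by blast
qed

lemma branch_order_valuation: "int_valuation branch_order"
  unfolding int_valuation_def
proof (intro conjI allI impI)
  fix f1 f2 :: 'f assume f: "f1 \<noteq> 0 \<and> f2 \<noteq> 0"
  obtain a1 b1 l1 l1' where 1: "G a1 l1" "G b1 l1'" "b1 \<noteq> 0" "f1 * b1 = a1" by (rule G_fraction)
  obtain a2 b2 l2 l2' where 2: "G a2 l2" "G b2 l2'" "b2 \<noteq> 0" "f2 * b2 = a2" by (rule G_fraction)
  have a0: "a1 \<noteq> 0" "a2 \<noteq> 0" using 1 2 f by auto
  have l0: "l1 \<noteq> 0" "l1' \<noteq> 0" "l2 \<noteq> 0" "l2' \<noteq> 0"
    using G_nonzero 1 2 a0 by metis+
  have "f1 * f2 * (b1 * b2) = a1 * a2" using 1(4) 2(4) by (auto simp: mult_ac)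
  from branch_order_eq[OF G_mult[OF 1(1) 2(1)] G_mult[OF 1(2) 2(2)] _ this] 1 2 f l0
  show "branch_order (f1 * f2) = branch_order f1 + branch_order f2"
    using branch_order_eq[OF 1] branch_order_eq[OF 2] by simp
next
  fix f1 f2 :: 'f assume f: "f1 \<noteq> 0 \<and> f2 \<noteq> 0 \<and> f1 + f2 \<noteq> 0"
  obtain a1 b1 l1 l1' where 1: "G a1 l1" "G b1 l1'" "b1 \<noteq> 0" "f1 * b1 = a1" by (rule G_fraction)
  obtain a2 b2 l2 l2' where 2: "G a2 l2" "G b2 l2'" "b2 \<noteq> 0" "f2 * b2 = a2" by (rule G_fraction)
  have a0: "a1 \<noteq> 0" "a2 \<noteq> 0" using 1 2 f by auto
  have l0: "l1 \<noteq> 0" "l1' \<noteq> 0" "l2 \<noteq> 0" "l2' \<noteq> 0"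
    using G_nonzero 1 2 a0 by metis+
  have e: "(f1 + f2) * (b1 * b2) = a1 * b2 + a2 * b1" using 1(4) 2(4) by (auto simp: algebra_simps)
  have b0: "b1 * b2 \<noteq> 0" using 1 2 by simp
  have s: "G (a1 * b2 + a2 * b1) (l1 * l2' + l2 * l1')"
    by (intro branch_graph.add G_mult 1 2)
  have "l1 * l2' + l2 * l1' \<noteq> 0"
    by (rule G_nonzero[OF s]) (use e b0 f in \<open>metis mult_eq_0_iff\<close>)
  hence "min (subdegree (l1 * l2')) (subdegree (l2 * l1')) \<le> subdegree (l1 * l2' + l2 * l1')"
    by (rule subdegree_add_ge')
  moreover have "branch_order (f1 + f2) = int (subdegree (l1 * l2' + l2 * l1')) - int (subdegree (l1' * l2'))"
    using f by (intro branch_order_eq[OF s G_mult[OF 1(2) 2(2)] b0 e]) auto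
  ultimately show "min (branch_order f1) (branch_order f2) \<le> branch_order (f1 + f2)"
    using branch_order_eq[OF 1] branch_order_eq[OF 2] f l0 by simp
qed

text \<open>
  The branch order is positive at \<open>h(z)\<close>, as \<open>h(c) = 0\<close>, and nonnegative on \<open>A\<close>.  Normalisation does
  not affect these signs.  An element of \<open>A\<close> with positive value vanishes at the point itself,
  which is the constant coefficient of its series.
\<close>
lemma place_at_branch:
  assumes h: "h \<in> polys_over k" "h \<noteq> 0" "poly (map_poly to_ac h) c = 0"
  obtains v where "v \<in> places k" "v x \<ge> 0" "v (poly h z) > 0"
    "\<And>f l. G f l \<Longrightarrow> f \<noteq> 0 \<Longrightarrow> v f > 0 \<Longrightarrow> l $ 0 = 0"
proof -
  have hz: "branch_order (poly h z) > 0"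
    using branch_order_A[OF G_poly[OF h(1)] poly_z_nonzero[OF h(1,2)]] h
    by (simp add: subdegree_eq_0_iff flip: neq0_conv)
  have c0: "branch_order a = 0" if "a \<in> k" for a
    using branch_order_A[OF G_const[OF that]] by (cases "a = 0") (auto simp: branch_order_def to_fps_def)
  have e0: "branch_order 0 = 0" by (simp add: branch_order_def)
  have pos: "\<exists>f. branch_order f > 0" using hz by blast
  obtain d where d: "d > 0" "\<And>f. d dvd branch_order f" "(\<lambda>f. branch_order f div d) \<in> places k"
    using normalise_valuation[OF branch_order_valuation e0 c0 pos] by blast
  show ?thesis
  proof (rule that[OF d(3)])
    show "branch_order x div d \<ge> 0"
      proof (cases "x = 0")
      case True
      hence "branch_order x = branch_order 0" by (rule arg_cong)
      thus ?thesis using e0 by simp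
    next
      case False
      thus ?thesis using branch_order_A[OF G_xyz(1)] d(1) by (simp add: pos_imp_zdiv_nonneg_iff)
    qed
    obtain m where "branch_order (poly h z) = d * m" using d(2) by (auto elim: dvdE)
    thus "branch_order (poly h z) div d > 0" using hz d(1) by (simp add: zero_less_mult_iff)
    fix f l assume *: "G f l" "f \<noteq> 0" "branch_order f div d > 0"
    have "branch_order f \<noteq> 0" using *(3) by auto
    hence "subdegree l \<noteq> 0" using branch_order_A[OF *(1,2)] by simp
    thus "l $ 0 = 0" by (metis subdegree_eq_0)
  qed
qed

end

context curve
begin

text \<open>
  First \<open>y = b + w\<close> with \<open>w^(q^2) - w = (c + t)^M - c^M\<close>, then \<open>x = a + w'\<close> with
  \<open>w'^q + w' = y^(q+1) - b^(q+1)\<close>; in both cases the right-hand side has constant term \<open>0\<close>.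
\<close>
lemma branch_exists:
  assumes ab: "b ^ (q\<^sup>2) - b = c ^ M" "a ^ q + a = b ^ (q + 1)"
  obtains Xt Yt where "curve_branch p e q M k x y z P_inf Xt Yt (fps_const c + fps_X) c" "Xt $ 0 = a" "Yt $ 0 = b"
proof -
  have pa: "of_nat p = (0 :: 'f alg_closure)" using arg_cong[OF char_p, of to_ac] by simp
  hence pf: "of_nat p = (0 :: 'f alg_closure fps)" by (simp add: fps_of_nat[symmetric])
  have q2: "q\<^sup>2 = p ^ (e * 2)" by (simp add: q_eq power_mult)
  have q2': "2 \<le> q\<^sup>2" using q_ge_2 self_le_power[of q 2] by linarith
  define Zt where "Zt = fps_const c + fps_X"
  define u where "u = Zt ^ M - fps_const (c ^ M)"
  have "u $ 0 = 0" by (simp add: u_def Zt_def fps_power_zeroth)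
  then obtain w where w: "w $ 0 = 0" "w ^ (q\<^sup>2) + fps_const (-1) * w = u"
    using fps_artin_schreier[OF prime_p pa q2 q2', of "-1" u] by auto
  define Yt where "Yt = fps_const b + w"
  have "Yt ^ (q\<^sup>2) - Yt = fps_const (b ^ (q\<^sup>2)) - fps_const b + (w ^ (q\<^sup>2) + fps_const (-1) * w)"
    unfolding Yt_def frobenius_add[OF prime_p pf q2 one_neq_zero]
    by (simp add: fps_const_power fps_const_neg[symmetric] del: fps_const_neg)
  also have "\<dots> = fps_const (b ^ (q\<^sup>2) - b) + u" unfolding w(2) by simp
  also have "\<dots> = Zt ^ M" by (simp add: ab u_def)
  finally have Yt: "Yt ^ (q\<^sup>2) - Yt = Zt ^ M" .
  have Y0: "Yt $ 0 = b" by (simp add: Yt_def w)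
  define u' where "u' = Yt ^ (q + 1) - fps_const (b ^ (q + 1))"
  have "u' $ 0 = 0" by (simp add: u'_def Y0 fps_power_zeroth)
  then obtain w' where w': "w' $ 0 = 0" "w' ^ q + fps_const 1 * w' = u'"
    using fps_artin_schreier[OF prime_p pa q_eq q_ge_2, of 1 u'] by auto
  define Xt where "Xt = fps_const a + w'"
  have "Xt ^ q + Xt = fps_const (a ^ q + a) + (w' ^ q + fps_const 1 * w')"
    unfolding Xt_def frobenius_add[OF prime_p pf q_eq one_neq_zero]
    by (simp add: fps_const_power fps_const_add[symmetric] del: fps_const_add)
  also have "\<dots> = Yt ^ (q + 1)" unfolding w'(2) ab u'_def by simp
  finally have Xt: "Xt ^ q + Xt = Yt ^ (q + 1)" .
  have "curve_branch p e q M k x y z P_inf Xt Yt Zt c"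
    by unfold_locales (use Xt Yt in \<open>simp_all add: Zt_def\<close>)
  thus ?thesis using that[of Xt Yt] Y0 w' by (simp add: Zt_def Xt_def)
qed

section \<open>Functions regular at all finite places\<close>

lemma point_exists: "\<exists>a b. b ^ (q\<^sup>2) - b = c ^ M \<and> a ^ q + a = b ^ (q + 1)"
  for c :: "'f alg_closure"
proof -
  have root: "\<exists>b. b ^ n + s * b = d" if "n \<ge> 2" for n and s d :: "'f alg_closure"
  proof -
    have "degree (monom 1 n + [:- d, s:]) = n"
      using that by (subst degree_add_eq_left) (auto simp: degree_monom_eq)
    hence "degree (monom 1 n + [:- d, s:]) > 0" using that by simp
    from alg_closed_imp_poly_has_root[OF this] obtain b where "poly (monom 1 n + [:- d, s:]) b = 0" by blast
    hence "b ^ n + s * b = d" by (simp add: poly_monom algebra_simps)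
    thus ?thesis by blast
  qed
  have "2 \<le> q\<^sup>2" using q_ge_2 self_le_power[of q 2] by linarith
  then obtain b where b: "b ^ (q\<^sup>2) + (-1) * b = c ^ M" using root by metis
  obtain a where "a ^ q + 1 * a = b ^ (q + 1)" using root[OF q_ge_2] by metis
  with b show ?thesis by auto
qed

text \<open>
  For fixed \<open>b\<close> the sum is a polynomial of degree below \<open>q\<close> in \<open>a\<close> with \<open>q\<close> zeros, so its coefficients
  vanish; these are polynomials of degree below \<open>q^2\<close> in \<open>b\<close> with \<open>q^2\<close> zeros.
\<close>
lemma vanishing_coefficients:
  fixes \<gamma> :: "nat \<times> nat \<Rightarrow> 'f alg_closure"
  assumes van: "\<And>a b. b ^ (q\<^sup>2) - b = c ^ M \<Longrightarrow> a ^ q + a = b ^ (q + 1) \<Longrightarrow>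
      (\<Sum>i\<in>Jdx. \<gamma> i * b ^ fst i * a ^ snd i) = 0"
    and i: "i \<in> Jdx"
  shows "\<gamma> i = 0"
proof -
  have pa: "of_nat p = (0 :: 'f alg_closure)" using arg_cong[OF char_p, of to_ac] by simp
  have qa: "of_nat q = (0 :: 'f alg_closure)" using pa e_pos by (simp add: q_eq)
  hence q2a: "of_nat (q\<^sup>2) = (0 :: 'f alg_closure)" by simp
  have q2': "2 \<le> q\<^sup>2" using q_ge_2 self_le_power[of q 2] by linarith
  have deg: "degree (\<Sum>i<n. monom (f i) i) < n" if "n > 0" for f :: "nat \<Rightarrow> 'f alg_closure" and n
    by (intro degree_sum_less) (use that in \<open>auto intro: le_less_trans[OF degree_monom_le]\<close>)
  have coeff: "coeff (\<Sum>i<n. monom (f i) i) j = f j" if "j < n" for f :: "nat \<Rightarrow> 'f alg_closure" and n j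
    using that by (simp add: coeff_sum)
  have inner: "(\<Sum>i<q\<^sup>2. \<gamma> (i, j) * b ^ i) = 0" if b: "b ^ (q\<^sup>2) - b = c ^ M" and j: "j < q" for b j
  proof -
    have "(\<Sum>j<q. monom (\<Sum>i<q\<^sup>2. \<gamma> (i, j) * b ^ i) j) = 0"
    proof (rule vanishing_on_artin_schreier_roots[OF qa q_ge_2, of 1 _ "b ^ (q + 1)"])
      fix a assume "a ^ q + 1 * a = b ^ (q + 1)"
      hence "0 = (\<Sum>i\<in>Jdx. \<gamma> i * b ^ fst i * a ^ snd i)" using van[OF b, of a] by simp
      also have "\<dots> = (\<Sum>i<q\<^sup>2. \<Sum>j<q. \<gamma> (i, j) * b ^ i * a ^ j)"
        by (simp add: sum.cartesian_product case_prod_beta)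
      also have "\<dots> = (\<Sum>j<q. \<Sum>i<q\<^sup>2. \<gamma> (i, j) * b ^ i * a ^ j)" by (rule sum.swap)
      finally show "poly (\<Sum>j<q. monom (\<Sum>i<q\<^sup>2. \<gamma> (i, j) * b ^ i) j) a = 0"
        by (simp add: poly_sum poly_monom sum_distrib_right)
    qed (use q_ge_2 deg in auto)
    with coeff[OF j, of "\<lambda>j. \<Sum>i<q\<^sup>2. \<gamma> (i, j) * b ^ i"] show ?thesis by simp
  qed
  obtain i1 i2 where i12: "i = (i1, i2)" "i1 < q\<^sup>2" "i2 < q" using i by auto
  have "(\<Sum>i<q\<^sup>2. monom (\<gamma> (i, i2)) i) = 0"
  proof (rule vanishing_on_artin_schreier_roots[OF q2a q2', of "-1" _ "c ^ M"])
    fix b assume "b ^ (q\<^sup>2) + (-1) * b = c ^ M"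
    thus "poly (\<Sum>i<q\<^sup>2. monom (\<gamma> (i, i2)) i) b = 0"
      using inner[of b i2] i12 by (simp add: poly_sum poly_monom)
  qed (use q2' deg[of "q\<^sup>2"] q_ge_2 in auto)
  with coeff[OF i12(2), of "\<lambda>i. \<gamma> (i, i2)"] i12 show ?thesis by simp
qed

text \<open>
  The field \<open>k\<close> is only a subset of the type of coefficients, so the division takes place in
  \<open>polys_over k\<close>; the factor \<open>l\<close> of the pseudo-division is invertible in \<open>k\<close>.
\<close>
lemma minimal_polynomial:
  fixes c :: "'f alg_closure"
  assumes h: "h \<in> polys_over k" "h \<noteq> 0" "poly (map_poly to_ac h) c = 0"
  obtains \<pi> where "\<pi> \<in> polys_over k" "\<pi> \<noteq> 0" "degree \<pi> > 0"
    "\<And>r. r \<in> polys_over k \<Longrightarrow> poly (map_poly to_ac r) c = 0 \<Longrightarrow> \<exists>s\<in>polys_over k. r = \<pi> * s"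
proof -
  define ev where "ev = (\<lambda>r. poly (map_poly to_ac r) c)"
  have ev_def': "ev r = taylor c r $ 0" for r by (simp add: ev_def)
  have ev: "ev (r + s) = ev r + ev s" "ev (r - s) = ev r - ev s" for r s
  proof -
    have "taylor c (r - s) = taylor c r - taylor c s"
      unfolding diff_conv_add_uminus taylor_simps(3,4) ..
    thus "ev (r + s) = ev r + ev s" "ev (r - s) = ev r - ev s"
      by (simp_all add: ev_def' del: taylor_simps(6))
  qed
  have ev_mult: "ev (r * s) = ev r * ev s" for r s
  proof (induction r)
    case (pCons a r)
    have sm: "ev (smult a s) = to_ac a * ev s" by (simp add: ev_def map_poly_smult)
    have pc: "ev (pCons b r) = to_ac b + c * ev r" for b r by (simp add: ev_def map_poly_pCons)
    have "ev (pCons a r * s) = ev (smult a s) + ev (pCons 0 (r * s))" by (simp add: ev)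
    thus ?case by (simp add: sm pc pCons algebra_simps)
  qed (simp add: ev_def)
  define S where "S = {r. r \<in> polys_over k \<and> r \<noteq> 0 \<and> ev r = 0}"
  have "\<exists>n. \<exists>r\<in>S. degree r = n" using h by (auto simp: S_def ev_def)
  from LeastI_ex[OF this] obtain \<pi> where \<pi>: "\<pi> \<in> S" "degree \<pi> = (LEAST n. \<exists>r\<in>S. degree r = n)" by blast
  have min: "degree \<pi> \<le> degree r" if "r \<in> S" for r
    unfolding \<pi>(2) using that by (intro Least_le) auto
  have \<pi>S: "\<pi> \<in> polys_over k" "\<pi> \<noteq> 0" "ev \<pi> = 0" using \<pi> by (auto simp: S_def)
  have deg: "degree \<pi> > 0"
  proof (rule ccontr)
    assume "\<not> degree \<pi> > 0"
    then obtain a where "\<pi> = [:a:]" by (metis degree_eq_zeroE neq0_conv)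
    with \<pi>S show False by (simp add: ev_def map_poly_pCons)
  qed
  have "\<exists>s\<in>polys_over k. r = \<pi> * s" if r: "r \<in> polys_over k" "ev r = 0" for r
  proof -
    obtain l Q R where *: "l \<in> k" "l \<noteq> 0" "Q \<in> polys_over k" "R \<in> polys_over k"
      "smult l r = Q * \<pi> + R" "R = 0 \<or> degree R < degree \<pi>"
      by (rule pseudo_division_over[OF kring \<pi>S(1,2) r(1)])
    have "ev R = ev ([:l:] * r - Q * \<pi>)" using * by simp
    also have "\<dots> = ev [:l:] * ev r - ev Q * ev \<pi>" by (simp only: ev ev_mult)
    also have "\<dots> = 0" by (simp add: r \<pi>S)
    finally have "R \<in> S \<or> R = 0" using * by (simp add: S_def)
    hence "R = 0" using min[of R] *(6) by auto
    have "r = smult (inverse l) (smult l r)" using *(2) by simp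
    also have "\<dots> = \<pi> * smult (inverse l) Q" using * \<open>R = 0\<close> by (simp add: mult.commute)
    finally show ?thesis using * k by (intro bexI[of _ "smult (inverse l) Q"])
      (auto simp: is_subfield_def intro!: polys_over_smult[OF kring])
  qed
  thus ?thesis using that[OF \<pi>S(1,2) deg] by (simp add: ev_def)
qed

text \<open>
  Take \<open>h\<close> of least degree with \<open>f h(z) \<in> A\<close>.  If \<open>h\<close> had a root \<open>c\<close>, then \<open>g = f h(z)\<close> would vanish at
  every point over \<open>c\<close>, the coefficients of \<open>g\<close> over \<open>k[z]\<close> would vanish at \<open>c\<close>, and the minimal
  polynomial of \<open>c\<close> could be cancelled from \<open>h\<close>.
\<close>
lemma regular_at_finite_places:
  assumes reg: "\<And>v. v \<in> places k \<Longrightarrow> v x \<ge> 0 \<Longrightarrow> regular_at v f"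
  shows "f \<in> A"
proof (cases "f = 0")
  case False
  define S where "S = {h. h \<in> polys_over k \<and> h \<noteq> 0 \<and> f * poly h z \<in> A}"
  obtain a0 b0 where ab0: "a0 \<in> A" "b0 \<in> A" "b0 \<noteq> 0" "f = a0 / b0" by (rule fraction)
  obtain a1 h1 where 1: "a1 \<in> A" "h1 \<in> polys_over k" "h1 \<noteq> 0" "b0 * a1 = poly h1 z"
    using multiple_in_Kz[OF ab0(2,3)] by metis
  have "f * poly h1 z = a0 * a1" using ab0 by (simp add: 1(4)[symmetric])
  hence "\<exists>n. \<exists>r\<in>S. degree r = n" using 1 ab0 is_subringD(4)[OF A_subring] by (auto simp: S_def)
  from LeastI_ex[OF this] obtain h where h': "h \<in> S" "degree h = (LEAST n. \<exists>r\<in>S. degree r = n)" by blast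
  have min: "degree h \<le> degree r" if "r \<in> S" for r
    unfolding h'(2) using that by (intro Least_le) auto
  have h: "h \<in> polys_over k" "h \<noteq> 0" "f * poly h z \<in> A" using h' by (auto simp: S_def)
  have "degree h = 0"
  proof (rule ccontr)
    assume dh: "degree h \<noteq> 0"
    have "degree (map_poly to_ac h) > 0" using dh by (simp add: degree_map_poly)
    then obtain c where c: "poly (map_poly to_ac h) c = 0" using alg_closed_imp_poly_has_root by blast
    define g where "g = f * poly h z"
    have hz: "poly h z \<noteq> 0" by (rule poly_z_nonzero[OF h(1,2)])
    have g0: "g \<noteq> 0" using False hz by (simp add: g_def)
    obtain a b where ab: "b ^ (q\<^sup>2) - b = c ^ M" "a ^ q + a = b ^ (q + 1)" using point_exists by blast
    obtain Xt Yt where XY: "curve_branch p e q M k x y z P_inf Xt Yt (fps_const c + fps_X) c"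
      using branch_exists[OF ab] by blast
    interpret B: curve_branch p e q M k x y z P_inf Xt Yt "fps_const c + fps_X" c by (rule XY)
    obtain l where "B.G g l" using h(3) B.A_iff_G by (auto simp: g_def)
    then obtain gc where gc: "\<And>i. gc i \<in> polys_over k" "g = (\<Sum>i\<in>Jdx. z_term (gc i) i)"
      by (rule B.G_normal_form) blast
    have van: "poly (map_poly to_ac (gc i)) c = 0" if "i \<in> Jdx" for i
    proof (rule vanishing_coefficients[OF _ that, where c = c])
      fix a b assume ab: "b ^ (q\<^sup>2) - b = c ^ M" "a ^ q + a = b ^ (q + 1)"
      obtain Xt Yt where XY: "curve_branch p e q M k x y z P_inf Xt Yt (fps_const c + fps_X) c"
        and 0: "Xt $ 0 = a" "Yt $ 0 = b"
        using branch_exists[OF ab] by blast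
      interpret C: curve_branch p e q M k x y z P_inf Xt Yt "fps_const c + fps_X" c by (rule XY)
      obtain v where v: "v \<in> places k" "v x \<ge> 0" "v (poly h z) > 0"
        "\<And>f l. C.G f l \<Longrightarrow> f \<noteq> 0 \<Longrightarrow> v f > 0 \<Longrightarrow> l $ 0 = 0"
        by (rule C.place_at_branch[OF h(1,2) c]) blast
      have "v g = v f + v (poly h z)"
        unfolding g_def by (rule val_mult[OF placeD(1)[OF v(1)] False hz])
      hence "v g > 0" using reg[OF v(1,2)] v(3) False by (simp add: regular_at_def)
      moreover have "C.G g (\<Sum>i\<in>Jdx. C.Z_term (gc i) i)"
        unfolding gc(2) by (intro C.G_sum C.G_z_term gc(1))
      ultimately have "(\<Sum>i\<in>Jdx. C.Z_term (gc i) i) $ 0 = 0" using v(4) g0 by blast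
      thus "(\<Sum>i\<in>Jdx. poly (map_poly to_ac (gc i)) c * b ^ fst i * a ^ snd i) = 0"
        by (simp add: fps_sum_nth C.Z_term_def fps_power_zeroth 0)
    qed
    obtain \<pi> where \<pi>: "\<pi> \<in> polys_over k" "\<pi> \<noteq> 0" "degree \<pi> > 0"
      "\<And>r. r \<in> polys_over k \<Longrightarrow> poly (map_poly to_ac r) c = 0 \<Longrightarrow> \<exists>s\<in>polys_over k. r = \<pi> * s"
      using minimal_polynomial[OF h(1,2) c] by blast
    obtain h2 where h2: "h2 \<in> polys_over k" "h = \<pi> * h2" using \<pi>(4)[OF h(1) c] by blast
    have "\<forall>i\<in>Jdx. \<exists>s\<in>polys_over k. gc i = \<pi> * s" using \<pi>(4)[OF gc(1) van] by blast
    then obtain s where s: "\<And>i. i \<in> Jdx \<Longrightarrow> s i \<in> polys_over k \<and> gc i = \<pi> * s i" by metis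
    have \<pi>z: "poly \<pi> z \<noteq> 0" by (rule poly_z_nonzero[OF \<pi>(1,2)])
    have "poly \<pi> z * (f * poly h2 z) = g" by (simp add: g_def h2 mult_ac)
    also have "g = (\<Sum>i\<in>Jdx. z_term (\<pi> * s i) i)" unfolding gc(2) using s by (intro sum.cong) auto
    also have "\<dots> = poly \<pi> z * (\<Sum>i\<in>Jdx. z_term (s i) i)"
      unfolding sum_distrib_left by (simp add: z_term_def mult_ac)
    finally have "f * poly h2 z = (\<Sum>i\<in>Jdx. z_term (s i) i)" using \<pi>z by simp
    also have "\<dots> \<in> A"
      unfolding z_term_def using s
      by (intro is_subring_sum[OF A_subring] is_subringD(4)[OF A_subring] A_power A_poly xyz_in_A) auto
    finally have "h2 \<in> S" using h2 h by (auto simp: S_def)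
    moreover have "degree h = degree \<pi> + degree h2" using h2 h(2) by (metis degree_mult_eq mult_zero_left mult_zero_right)
    ultimately show False using min[of h2] \<pi>(3) by simp
  qed
  then obtain a where a: "h = [:a:]" by (rule degree_eq_zeroE)
  with h have "a \<in> k" "a \<noteq> 0" by (auto simp: kring)
  hence "inverse a \<in> A" using k k_subset_A by (auto simp: is_subfield_def)
  hence "f * poly h z * inverse a \<in> A" using is_subringD(4)[OF A_subring h(3)] by simp
  thus ?thesis using a \<open>a \<noteq> 0\<close> by (simp add: mult.assoc)
qed (simp add: is_subringD[OF A_subring])

end

section \<open>The semigroup of the chosen points\<close>

locale curve_points = curve p e q M k x y z P_inf
  for p e q M :: nat and k :: "'f::field set" and x y z :: 'f and P_inf :: "'f \<Rightarrow> int" +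
  fixes m :: nat and \<alpha> :: "nat \<Rightarrow> 'f" and P :: "nat \<Rightarrow> 'f \<Rightarrow> int"
  assumes m_pos: "1 \<le> m" and inj_\<alpha>: "inj_on \<alpha> {1..m}"
    and \<alpha>: "l \<in> {1..m} \<Longrightarrow> \<alpha> l \<in> k" "l \<in> {1..m} \<Longrightarrow> \<alpha> l ^ q + \<alpha> l = 0"
    and P: "l \<in> {1..m} \<Longrightarrow> P l \<in> places k" "l \<in> {1..m} \<Longrightarrow> P l (x - \<alpha> l) > 0"
begin

definition pts :: "('f \<Rightarrow> int) list" where "pts = P_inf # map P [1..<m + 1]"

definition pole_orders :: "'f \<Rightarrow> int list" where "pole_orders h = map (\<lambda>v. - v h) pts"

definition regular_off_pts :: "'f \<Rightarrow> bool" where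
  "regular_off_pts h \<longleftrightarrow> (\<forall>v\<in>places k - set pts. regular_at v h)"

lemma set_pts: "set pts = insert P_inf (P ` {1..m})"
  by (auto simp: pts_def)

lemma length_pts [simp]: "length pts = m + 1"
  by (simp add: pts_def)

lemma pts_places: "v \<in> set pts \<Longrightarrow> v \<in> places k"
  using P P_inf by (auto simp: set_pts)

lemma gen_weierstrass_pts: "gen_weierstrass k pts = {pole_orders h | h. h \<noteq> 0 \<and> regular_off_pts h}"
  by (simp add: gen_weierstrass_def pole_orders_def regular_off_pts_def)

lemma length_pole_orders [simp]: "length (pole_orders h) = m + 1"
  by (simp add: pole_orders_def)

lemma nth_pole_orders: "j < m + 1 \<Longrightarrow> pole_orders h ! j = - (pts ! j) h"
  by (simp add: pole_orders_def)

lemma pole_orders_0: "pole_orders h ! 0 = - P_inf h"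
  by (simp add: pole_orders_def pts_def)

lemma pole_orders_l: "l \<in> {1..m} \<Longrightarrow> pole_orders h ! l = - P l h"
  by (cases l) (simp_all add: pole_orders_def pts_def del: upt_Suc)

lemma pole_orders_eq: "pole_orders h = (- P_inf h) # map (\<lambda>l. - P l h) [1..<m + 1]"
  by (simp add: pole_orders_def pts_def)

definition root_prod :: "(nat \<Rightarrow> nat) \<Rightarrow> 'f poly" where
  "root_prod n = (\<Prod>l\<in>{1..m}. [:- \<alpha> l, 1:] ^ n l)"

lemma root_prod: "root_prod n \<in> polys_over k" "root_prod n \<noteq> 0" "degree (root_prod n) = (\<Sum>l\<in>{1..m}. n l)"
proof -
  show "root_prod n \<in> polys_over k"
    unfolding root_prod_def
    using \<alpha>(1) kring is_subringD[OF kring] by (intro polys_over_prod polys_over_power) auto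
  show "root_prod n \<noteq> 0" by (simp add: root_prod_def)
  have "degree (root_prod n) = (\<Sum>l\<in>{1..m}. degree ([:- \<alpha> l, 1:] ^ n l))"
    unfolding root_prod_def by (intro degree_prod_eq_sum_degree) auto
  thus "degree (root_prod n) = (\<Sum>l\<in>{1..m}. n l)" by (simp add: degree_power_eq)
qed

lemma order_root_prod:
  assumes j: "j \<in> {1..m}" shows "order (\<alpha> j) (root_prod n) = n j"
proof -
  have "order (\<alpha> j) (\<Prod>l\<in>L. [:- \<alpha> l, 1:] ^ n l) = (if j \<in> L then n j else 0)"
    if "finite L" "L \<subseteq> {1..m}" for L
    using that
  proof (induction L rule: finite_induct)
    case (insert l L)
    have nz: "[:- \<alpha> l, 1:] ^ n l * (\<Prod>l\<in>L. [:- \<alpha> l, 1:] ^ n l) \<noteq> 0" using insert by auto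
    have "order (\<alpha> j) ([:- \<alpha> l, 1:] ^ n l) = (if j = l then n l else 0)"
    proof (cases "j = l")
      case False
      hence "\<alpha> j \<noteq> \<alpha> l" using inj_\<alpha> j insert.prems by (auto dest: inj_onD)
      hence "poly ([:- \<alpha> l, 1:] ^ n l) (\<alpha> j) \<noteq> 0" by (simp add: poly_power)
      thus ?thesis using False by (simp add: order_0I)
    qed (use order_power_n_n in auto)
    thus ?case using insert by (auto simp: order_mult[OF nz])
  qed simp
  from this[of "{1..m}"] j show ?thesis by (simp add: root_prod_def)
qed

text \<open>The zeros of \<open>r\<close> among the distinct elements \<open>\<alpha> l\<close>, counted with multiplicity.\<close>
lemma sum_orders_le_degree:
  assumes r: "r \<noteq> 0" shows "(\<Sum>l\<in>{1..m}. order (\<alpha> l) r) \<le> degree r"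
proof -
  have fin: "finite {a. poly r a = 0}" using r by (rule poly_roots_finite)
  have "(\<Sum>l\<in>{1..m}. order (\<alpha> l) r) = (\<Sum>a\<in>\<alpha> ` {1..m}. order a r)"
    using inj_\<alpha> by (simp add: sum.reindex)
  also have "\<dots> = (\<Sum>a\<in>\<alpha> ` {1..m} \<inter> {a. poly r a = 0}. order a r)"
    by (intro sum.mono_neutral_right) (auto simp: order_0I)
  also have "\<dots> \<le> (\<Sum>a | poly r a = 0. order a r)"
    using fin by (intro sum_mono2) auto
  also have "\<dots> \<le> degree r" using r by (rule sum_order_le_degree)
  finally show ?thesis .
qed

section \<open>Components of functions regular off the points\<close>

definition denom :: "nat \<Rightarrow> 'f poly" where "denom N = root_prod (\<lambda>_. N)"

definition component :: "nat \<Rightarrow> 'f poly \<Rightarrow> nat \<times> nat \<Rightarrow> 'f" where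
  "component N r i = x_term r i / poly (denom N) x"

lemma denom: "denom N \<in> polys_over k" "denom N \<noteq> 0" "degree (denom N) = m * N"
  "l \<in> {1..m} \<Longrightarrow> order (\<alpha> l) (denom N) = N"
  using root_prod[of "\<lambda>_. N"] order_root_prod[of l "\<lambda>_. N"] by (auto simp: denom_def)

lemma weighs_pts:
  shows "weighs P_inf wt_inf" "l \<in> {1..m} \<Longrightarrow> weighs (P l) (wt_at (\<alpha> l))"
  using weighs_inf[OF P_inf P_inf_x] weighs_at P \<alpha> by auto

lemma pts_weighted:
  assumes "v \<in> set pts" obtains w where "weighs v w" "separating w"
proof (cases "v = P_inf")
  case True
  thus ?thesis using that weighs_pts(1) separating_wt_inf by simp
next
  case False
  then obtain l where "l \<in> {1..m}" "v = P l" using assms by (auto simp: set_pts)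
  thus ?thesis using that weighs_pts(2) separating_wt_at by metis
qed

lemma val_denom:
  "P_inf (poly (denom N) x) = - (E * (int m * int N))"
  "l \<in> {1..m} \<Longrightarrow> P l (poly (denom N) x) = E * int N"
  "poly (denom N) x \<noteq> 0"
proof -
  note D = denom[where N = N]
  have t: "x_term (denom N) (0, 0) = poly (denom N) x" by (simp add: x_term_def)
  show "P_inf (poly (denom N) x) = - (E * (int m * int N))" "poly (denom N) x \<noteq> 0"
    using weighsD[OF weighs_pts(1) D(1,2), of "(0, 0)"] D(3) t by (simp_all add: wt_inf_def)
  show "P l (poly (denom N) x) = E * int N" if l: "l \<in> {1..m}"
    using weighsD(2)[OF weighs_pts(2)[OF l] D(1,2), of "(0, 0)"] D(4)[OF l] t by (simp add: wt_at_def)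
qed

lemma component:
  assumes r: "r \<in> polys_over k" "r \<noteq> 0"
  shows "component N r i \<noteq> 0"
    "P_inf (component N r i) = - (E * (int (degree r) - int m * int N) + int q * int M * int (fst i)
       + int q ^ 3 * int (snd i))"
    "l \<in> {1..m} \<Longrightarrow> P l (component N r i) = E * (int (order (\<alpha> l) r) - int N) + int M * int (fst i) + int (snd i)"
proof -
  have t: "x_term r i \<noteq> 0" "P_inf (x_term r i) = wt_inf r i"
    using weighsD[OF weighs_pts(1) r] by auto
  thus "component N r i \<noteq> 0" using val_denom(3) by (simp add: component_def)
  show "P_inf (component N r i) = - (E * (int (degree r) - int m * int N) + int q * int M * int (fst i)
       + int q ^ 3 * int (snd i))"
    unfolding component_def val_divide[OF placeD(1)[OF P_inf] t(1) val_denom(3)] t(2) val_denom(1) wt_inf_def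
    by (simp add: algebra_simps)
  assume l: "l \<in> {1..m}"
  have t2: "P l (x_term r i) = wt_at (\<alpha> l) r i" by (rule weighsD(2)[OF weighs_pts(2)[OF l] r])
  show "P l (component N r i) = E * (int (order (\<alpha> l) r) - int N) + int M * int (fst i) + int (snd i)"
    unfolding component_def val_divide[OF placeD(1)[OF P(1)[OF l]] t(1) val_denom(3)] t2 val_denom(2)[OF l] wt_at_def
    by (simp add: algebra_simps)
qed

lemma x_term_in_A: "r \<in> polys_over k \<Longrightarrow> x_term r i \<in> A"
  unfolding x_term_def by (intro is_subringD(4)[OF A_subring] A_poly A_power xyz_in_A)

lemma x_minus_root_nonzero: "l \<in> {1..m} \<Longrightarrow> x - \<alpha> l \<noteq> 0"
  using P(2)[of l] placeD(2)[OF P(1)[of l]] by auto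

lemma poly_denom: "poly (denom N) x = (\<Prod>l\<in>{1..m}. (x - \<alpha> l) ^ N)"
  by (simp add: denom_def root_prod_def poly_prod poly_power)

lemma x_minus_root_in_A: "l \<in> {1..m} \<Longrightarrow> x - \<alpha> l \<in> A"
  using \<alpha>(1) k_subset_A xyz_in_A(1) by (intro is_subringD(3)[OF A_subring]) auto

text \<open>
  A place with a pole of \<open>x\<close> is \<open>P_inf\<close>, and a place where \<open>x - \<alpha> l\<close> vanishes is \<open>P l\<close>.
\<close>
lemma denom_unit_off_pts:
  assumes v: "v \<in> places k - set pts"
  shows "v x \<ge> 0" "v (poly (denom N) x) = 0"
proof -
  from v have vp: "v \<in> places k" by simp
  note V = placeD(1)[OF vp]
  show vx: "v x \<ge> 0"
  proof (rule ccontr)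
    assume "\<not> v x \<ge> 0"
    hence "v = P_inf" by (intro place_with_pole_of_x[OF vp]) simp
    thus False using v by (simp add: set_pts)
  qed
  have "v (x - \<alpha> l) = 0" if l: "l \<in> {1..m}" for l
  proof -
    have "v (x - \<alpha> l) \<ge> 0"
      using regular_on_A[OF vp vx x_minus_root_in_A[OF l]] x_minus_root_nonzero[OF l]
      by (simp add: regular_at_def)
    moreover have "\<not> v (x - \<alpha> l) > 0"
    proof
      assume "v (x - \<alpha> l) > 0"
      hence "v = P l" using place_above_root_unique[OF vp P(1)[OF l] \<alpha>(1)[OF l] \<alpha>(2)[OF l] _ P(2)[OF l]] by simp
      thus False using v l by (simp add: set_pts)
    qed
    ultimately show ?thesis by simp
  qed
  thus "v (poly (denom N) x) = 0"
    unfolding poly_denom using x_minus_root_nonzero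
    by (subst val_prod[OF V]) (auto simp: val_power[OF V] intro!: sum.neutral)
qed

lemma component_regular:
  assumes r: "r \<in> polys_over k" "r \<noteq> 0"
  shows "regular_off_pts (component N r i)"
  unfolding regular_off_pts_def
proof
  fix v assume v: "v \<in> places k - set pts"
  hence vp: "v \<in> places k" by simp
  have t: "x_term r i \<noteq> 0" using component(1)[OF r] by (auto simp: component_def)
  have "v (component N r i) = v (x_term r i)"
    unfolding component_def val_divide[OF placeD(1)[OF vp] t val_denom(3)] denom_unit_off_pts(2)[OF v] by simp
  moreover have "regular_at v (x_term r i)"
    by (rule regular_on_A[OF vp denom_unit_off_pts(1)[OF v] x_term_in_A[OF r(1)]])
  ultimately show "regular_at v (component N r i)" using t by (simp add: regular_at_def)
qed

lemma component_in_semigroup: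
  assumes "r \<in> polys_over k" "r \<noteq> 0"
  shows "pole_orders (component N r i) \<in> gen_weierstrass k pts"
  unfolding gen_weierstrass_pts using component(1)[OF assms] component_regular[OF assms] by blast

text \<open>
  At every chosen point the value of \<open>f\<close> is the least value of its components.  The terms are
  \<open>r(x) y^b z^d\<close> over the common denominator \<open>\<Prod>(x - \<alpha> l)^N\<close>.
\<close>
definition decomposes :: "'f \<Rightarrow> nat \<Rightarrow> (nat \<times> nat \<Rightarrow> 'f poly) \<Rightarrow> bool" where
  "decomposes f N r \<longleftrightarrow> (\<forall>i. r i \<in> polys_over k) \<and>
     (\<forall>v\<in>set pts. (\<exists>i\<in>Idx. r i \<noteq> 0 \<and> v f = v (component N (r i) i)) \<and>
       (\<forall>i\<in>Idx. r i \<noteq> 0 \<longrightarrow> v f \<le> v (component N (r i) i)))"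

lemma decomposesD:
  assumes "decomposes f N r"
  shows "r i \<in> polys_over k"
    "v \<in> set pts \<Longrightarrow> \<exists>i\<in>Idx. r i \<noteq> 0 \<and> v f = v (component N (r i) i)"
    "v \<in> set pts \<Longrightarrow> i \<in> Idx \<Longrightarrow> r i \<noteq> 0 \<Longrightarrow> v f \<le> v (component N (r i) i)"
  using assms unfolding decomposes_def by blast+

text \<open>
  For large \<open>N\<close> the denominator cancels the poles of \<open>f\<close> at \<open>P 1, \<dots>, P m\<close>, so the product is
  regular wherever \<open>x\<close> is and lies in \<open>A\<close>.
\<close>
lemma decomposition:
  assumes f: "f \<noteq> 0" "regular_off_pts f"
  obtains N r where "decomposes f N r"
proof -
  define N where "N = (\<Sum>l\<in>{1..m}. nat \<bar>P l f\<bar>)"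
  define D where "D = poly (denom N) x"
  have D0: "D \<noteq> 0" unfolding D_def by (rule val_denom(3))
  have "f * D \<in> A"
  proof (rule regular_at_finite_places)
    fix v assume v: "v \<in> places k" "v x \<ge> 0"
    have vfD: "v (f * D) = v f + v D" by (rule val_mult[OF placeD(1)[OF v(1)] f(1) D0])
    show "regular_at v (f * D)"
    proof (cases "v \<in> set pts")
      case False
      hence "regular_at v f" "v D = 0"
        using f(2) v denom_unit_off_pts(2)[of v N] by (auto simp: regular_off_pts_def D_def)
      thus ?thesis using vfD f(1) by (simp add: regular_at_def)
    next
      case True
      moreover have "v \<noteq> P_inf" using v(2) P_inf_x by auto
      ultimately obtain l where l: "l \<in> {1..m}" "v = P l" by (auto simp: set_pts)
      have "nat \<bar>P l f\<bar> \<le> N" unfolding N_def using l by (intro member_le_sum) auto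
      hence "\<bar>P l f\<bar> \<le> 1 * int N" by simp
      also have "\<dots> \<le> E * int N"
      proof (rule mult_right_mono)
        have "1 * 1 \<le> E" using M_pos by (intro mult_mono) auto
        thus "1 \<le> E" by simp
      qed simp
      finally have "\<bar>P l f\<bar> \<le> P l D" unfolding D_def val_denom(2)[OF l(1)] .
      hence "0 \<le> P l f + P l D" by linarith
      thus ?thesis using vfD l by (simp add: regular_at_def)
    qed
  qed
  then obtain r where r: "\<And>i. r i \<in> polys_over k" "f * D = x_sum r"
    using A_eq_x_sum by blast
  have fD: "f * D \<noteq> 0" using f D0 by simp
  have nz: "\<exists>i\<in>Idx. r i \<noteq> 0" using x_sum_nonzero_iff fD r(2) by simp
  have vf: "v f = v (x_sum r) - v D" and vc: "r i \<noteq> 0 \<Longrightarrow> v (component N (r i) i) = v (x_term (r i) i) - v D"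
    if "v \<in> set pts" for v i
  proof -
    note V = placeD(1)[OF pts_places[OF that]]
    show "v f = v (x_sum r) - v D" using val_mult[OF V f(1) D0] by (simp add: r(2))
    assume "r i \<noteq> 0"
    hence "x_term (r i) i \<noteq> 0" using component(1)[OF r(1)] by (auto simp: component_def)
    thus "v (component N (r i) i) = v (x_term (r i) i) - v D"
      unfolding component_def D_def by (rule val_divide[OF V _ val_denom(3)])
  qed
  show ?thesis
  proof (rule that[of N r], unfold decomposes_def, intro conjI allI ballI impI)
    fix v assume v: "v \<in> set pts"
    obtain w where w: "weighs v w" "separating w" by (rule pts_weighted[OF v])
    note S = weighs_x_sum[OF pts_places[OF v] w r(1) nz]
    have wt: "w (r i) i = v (x_term (r i) i)" if "r i \<noteq> 0" for i
      using weighsD(2)[OF w(1) r(1) that] by simp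
    show "\<exists>i\<in>Idx. r i \<noteq> 0 \<and> v f = v (component N (r i) i)"
      using S(2) vf[OF v] vc[OF v] wt by fastforce
    fix i assume "i \<in> Idx" "r i \<noteq> 0"
    thus "v f \<le> v (component N (r i) i)" using S(3) vf[OF v] vc[OF v] wt by fastforce
  qed (rule r(1))
qed

text \<open>
  After multiplication by both denominators the components become terms, and a separating weight
  applies.
\<close>
lemma component_separated:
  assumes v: "v \<in> set pts" and ij: "i \<in> Idx" "j \<in> Idx"
    and r: "r \<in> polys_over k" "r \<noteq> 0" and s: "s \<in> polys_over k" "s \<noteq> 0"
    and eq: "v (component N r i) = v (component L s j)"
  shows "i = j"
proof -
  note V = placeD(1)[OF pts_places[OF v]]
  obtain w where w: "weighs v w" "separating w" by (rule pts_weighted[OF v])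
  have *: "v (component N r i) = w (r * denom L) i - v (poly (denom N) x) - v (poly (denom L) x)"
    if r: "r \<in> polys_over k" "r \<noteq> 0" for N L r i
  proof -
    have rL: "r * denom L \<in> polys_over k" "r * denom L \<noteq> 0"
      using r denom by (auto intro: polys_over_mult[OF kring])
    have t: "x_term r i \<noteq> 0" using component(1)[OF r] by (auto simp: component_def)
    have "w (r * denom L) i = v (x_term (r * denom L) i)" using weighsD(2)[OF w(1) rL] by simp
    also have "x_term (r * denom L) i = x_term r i * poly (denom L) x" by (simp add: x_term_def mult_ac)
    also have "v \<dots> = v (x_term r i) + v (poly (denom L) x)" by (rule val_mult[OF V t val_denom(3)])
    finally show ?thesis unfolding component_def val_divide[OF V t val_denom(3)] by simp
  qed
  have "w (r * denom L) i = w (s * denom N) j" 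
    using eq *[OF r, where N = N and i = i and L = L] *[OF s, where N = L and i = j and L = N] by simp
  thus ?thesis using w(2) ij unfolding separating_def by blast
qed

section \<open>Absolute maximal elements are the pole orders of monomials\<close>

lemma abs_maximal_in_semigroup: "\<beta> \<in> abs_maximal k pts \<Longrightarrow> \<beta> \<in> gen_weierstrass k pts"
  by (simp add: abs_maximal_def)

text \<open>
  The set \<open>J\<close> of coordinates where the two vectors agree is nonempty; if it were proper, the smaller
  vector would lie in \<open>nabla k pts J \<beta>\<close>.
\<close>
lemma not_abs_maximal_if_dominated:
  assumes \<beta>: "\<beta> \<in> abs_maximal k pts" and g: "\<gamma> \<in> gen_weierstrass k pts"
    and le: "\<And>j. j < m + 1 \<Longrightarrow> \<gamma> ! j \<le> \<beta> ! j" and eq: "a < m + 1" "\<gamma> ! a = \<beta> ! a"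
  shows "\<gamma> = \<beta>"
proof (rule ccontr)
  assume ne: "\<gamma> \<noteq> \<beta>"
  have len: "length \<gamma> = m + 1" "length \<beta> = m + 1"
    using g abs_maximal_in_semigroup[OF \<beta>] by (auto simp: gen_weierstrass_pts)
  define J where "J = {j. j < m + 1 \<and> \<gamma> ! j = \<beta> ! j}"
  have "J \<noteq> {..<m + 1}"
  proof
    assume "J = {..<m + 1}"
    hence "\<gamma> ! j = \<beta> ! j" if "j < m + 1" for j using that by (auto simp: J_def set_eq_iff)
    hence "\<gamma> = \<beta>" using len by (intro nth_equalityI) auto
    thus False using ne by simp
  qed
  hence J: "J \<noteq> {}" "J \<subset> {..<length pts}" using eq by (auto simp: J_def)
  have "\<gamma> \<in> nabla k pts J \<beta>"
    using g le by (auto simp: nabla_def J_def order_less_le)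
  thus False using \<beta> J by (auto simp: abs_maximal_def)
qed

text \<open>
  The component that realises the pole order at \<open>P_inf\<close> has the whole vector \<open>\<beta>\<close>.  Replacing its
  coefficient by the product of its factors \<open>x - \<alpha> l\<close> keeps the coordinates at \<open>P 1, \<dots>, P m\<close>,
  and the degree cannot drop, again by maximality.
\<close>
lemma abs_maximal_is_component:
  assumes \<beta>: "\<beta> \<in> abs_maximal k pts"
  obtains N n i where "i \<in> Idx" "\<beta> = pole_orders (component N (root_prod n) i)"
proof -
  obtain f where f: "f \<noteq> 0" "regular_off_pts f" "\<beta> = pole_orders f"
    using abs_maximal_in_semigroup[OF \<beta>] by (auto simp: gen_weierstrass_pts)
  obtain N r where dec: "decomposes f N r" by (rule decomposition[OF f(1,2)])
  note r = decomposesD[OF dec]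
  have "P_inf \<in> set pts" by (simp add: set_pts)
  from r(2)[OF this] obtain i where i: "i \<in> Idx" "r i \<noteq> 0" "P_inf f = P_inf (component N (r i) i)" by blast
  define s where "s = r i"
  have s: "s \<in> polys_over k" "s \<noteq> 0" using r(1) i(2) by (auto simp: s_def)
  have eq1: "pole_orders (component N s i) = \<beta>"
  proof (rule not_abs_maximal_if_dominated[OF \<beta> component_in_semigroup[OF s], where a = 0])
    fix j assume j: "j < m + 1"
    have "pts ! j \<in> set pts" using j by (intro nth_mem) simp
    from r(3)[OF this i(1,2)] show "pole_orders (component N s i) ! j \<le> \<beta> ! j"
      using j by (simp add: f(3) nth_pole_orders s_def)
  qed (use i(3) in \<open>simp_all add: f(3) pole_orders_0 s_def\<close>)
  define n where "n = (\<lambda>l. order (\<alpha> l) s)"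
  note n = root_prod[of n]
  have l: "pole_orders (component N (root_prod n) i) ! l = \<beta> ! l" if "l \<in> {1..m}" for l
    unfolding eq1[symmetric] pole_orders_l[OF that] component(3)[OF s that] component(3)[OF n(1,2) that]
      order_root_prod[OF that] by (simp add: n_def)
  have "pole_orders (component N (root_prod n) i) = \<beta>"
  proof (rule not_abs_maximal_if_dominated[OF \<beta> component_in_semigroup[OF n(1,2)], where a = 1])
    fix j assume j: "j < m + 1"
    show "pole_orders (component N (root_prod n) i) ! j \<le> \<beta> ! j"
    proof (cases "j = 0")
      case True
      have "degree (root_prod n) \<le> degree s" using sum_orders_le_degree[OF s(2)] n(3) by (simp add: n_def)
      hence "E * int (degree (root_prod n)) \<le> E * int (degree s)" by (intro mult_left_mono) auto
      thus ?thesis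
        unfolding True eq1[symmetric] pole_orders_0 component(2)[OF s] component(2)[OF n(1,2)]
        by (simp add: algebra_simps)
    qed (use l[of j] j in auto)
  qed (use l[of 1] m_pos in auto)
  with that i(1) show ?thesis by metis
qed

definition total_order :: "'f \<Rightarrow> int" where "total_order h = (\<Sum>j<m + 1. pole_orders h ! j)"

lemma total_order_eq: "total_order h = - P_inf h + (\<Sum>l\<in>{1..m}. - P l h)"
proof -
  have "total_order h = pole_orders h ! 0 + (\<Sum>j<m. pole_orders h ! Suc j)"
    by (simp add: total_order_def sum.lessThan_Suc_shift del: sum.lessThan_Suc)
  also have "(\<Sum>j<m. pole_orders h ! Suc j) = (\<Sum>l\<in>{1..m}. pole_orders h ! l)"
    by (rule sum.reindex_bij_witness[of _ "\<lambda>l. l - 1" Suc]) auto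
  also have "\<dots> = (\<Sum>l\<in>{1..m}. - P l h)" by (intro sum.cong refl pole_orders_l)
  finally show ?thesis by (simp add: pole_orders_0)
qed

text \<open>The exponent \<open>N\<close> cancels because the denominator has as many zeros as poles.\<close>
lemma total_order_component:
  assumes r: "r \<in> polys_over k" "r \<noteq> 0"
  shows "total_order (component N r i) = E * (int (degree r) - (\<Sum>l\<in>{1..m}. int (order (\<alpha> l) r)))
    + int q * int M * int (fst i) + int q ^ 3 * int (snd i) - int m * (int M * int (fst i) + int (snd i))"
proof -
  have "(\<Sum>l\<in>{1..m}. - P l (component N r i)) =
      (\<Sum>l\<in>{1..m}. (E * int N - int M * int (fst i) - int (snd i)) - E * int (order (\<alpha> l) r))"
    by (intro sum.cong refl) (simp add: component(3)[OF r] algebra_simps)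
  also have "\<dots> = int m * (E * int N - int M * int (fst i) - int (snd i)) - E * (\<Sum>l\<in>{1..m}. int (order (\<alpha> l) r))"
    by (simp add: sum_subtractf sum_distrib_left)
  finally show ?thesis unfolding total_order_eq component(2)[OF r] by (simp add: algebra_simps)
qed

text \<open>
  Among the components with exponents \<open>i\<close> the total pole order is smallest for a product of the
  factors \<open>x - \<alpha> l\<close>, so none of them can lie strictly below it in a coordinate.
\<close>
lemma component_abs_maximal:
  assumes i: "i \<in> Idx"
  shows "pole_orders (component N (root_prod n) i) \<in> abs_maximal k pts"
proof -
  note n = root_prod[of n]
  define h where "h = component N (root_prod n) i"
  have "nabla k pts J (pole_orders h) = {}" if J: "J \<noteq> {}" "J \<subset> {..<length pts}" for J
  proof (rule ccontr)
    assume "nabla k pts J (pole_orders h) \<noteq> {}"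
    then obtain f where f: "f \<noteq> 0" "regular_off_pts f" and fJ: "\<forall>j\<in>J. pole_orders f ! j = pole_orders h ! j"
      and fnJ: "\<forall>j\<in>{..<length pts} - J. pole_orders f ! j < pole_orders h ! j"
      by (auto simp: nabla_def gen_weierstrass_pts)
    obtain L r where dec: "decomposes f L r" by (rule decomposition[OF f(1,2)])
    note r = decomposesD[OF dec]
    obtain j where j: "j \<in> J" "j < m + 1" using J by auto
    have v: "pts ! j \<in> set pts" using j by (intro nth_mem) simp
    from r(2)[OF v] obtain i' where i': "i' \<in> Idx" "r i' \<noteq> 0" "(pts ! j) f = (pts ! j) (component L (r i') i')" by blast
    have "(pts ! j) (component L (r i') i') = (pts ! j) h"
      using fJ j i'(3) by (auto simp: nth_pole_orders)
    from component_separated[OF v i'(1) i r(1) i'(2) n(1,2) this[unfolded h_def]]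
    have ii: "i' = i" .
    define s where "s = r i"
    have s: "s \<in> polys_over k" "s \<noteq> 0" using r(1) i'(2) ii by (auto simp: s_def)
    have "total_order (component L s i) \<le> total_order f"
      unfolding total_order_def
    proof (rule sum_mono)
      fix j assume j: "j \<in> {..<m + 1}"
      hence "pts ! j \<in> set pts" by (intro nth_mem) simp
      from r(3)[OF this i'(1,2)] show "pole_orders (component L s i) ! j \<le> pole_orders f ! j"
        using j ii by (simp add: nth_pole_orders s_def)
    qed
    also have "total_order f < total_order h"
      unfolding total_order_def
    proof (rule sum_strict_mono_ex1)
      show "\<forall>j\<in>{..<m + 1}. pole_orders f ! j \<le> pole_orders h ! j"
        using fJ fnJ by (metis DiffI length_pts order.order_iff_strict)
      show "\<exists>j\<in>{..<m + 1}. pole_orders f ! j < pole_orders h ! j"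
        using fnJ J by (metis DiffI length_pts psubset_imp_ex_mem DiffD1)
    qed simp
    finally have lt: "total_order (component L s i) < total_order h" .
    have "(\<Sum>l\<in>{1..m}. int (order (\<alpha> l) s)) \<le> int (degree s)"
      using sum_orders_le_degree[OF s(2)] by (simp flip: of_nat_sum)
    hence "0 \<le> E * (int (degree s) - (\<Sum>l\<in>{1..m}. int (order (\<alpha> l) s)))"
      by (intro mult_nonneg_nonneg) auto
    moreover have "int (degree (root_prod n)) - (\<Sum>l\<in>{1..m}. int (order (\<alpha> l) (root_prod n))) = 0"
      using n(3) order_root_prod[of _ n] by simp
    ultimately show False using lt unfolding h_def total_order_component[OF s] total_order_component[OF n(1,2)] by simp
  qed
  thus ?thesis using component_in_semigroup[OF n(1,2)] by (simp add: abs_maximal_def h_def)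
qed

section \<open>The absolute maximal elements in the box\<close>

text \<open>The monomial \<open>\<Prod>(x - \<alpha> l)^(n - N) y^b z^d\<close> with the same exponent at every root.\<close>
lemma pole_orders_component_const:
  "pole_orders (component N (root_prod (\<lambda>_. n)) (b, d)) =
     (E * int m * (int n - int N) + int q * int M * int b + int q ^ 3 * int d)
     # replicate m (E * (int N - int n) - int M * int b - int d)"
proof -
  note r = root_prod[of "\<lambda>_. n"]
  have "map (\<lambda>l. - P l (component N (root_prod (\<lambda>_. n)) (b, d))) [1..<m + 1] =
      map (\<lambda>_. E * (int N - int n) - int M * int b - int d) [1..<m + 1]"
  proof (intro map_cong refl)
    fix l assume "l \<in> set [1..<m + 1]"
    hence l: "l \<in> {1..m}" by auto
    show "- P l (component N (root_prod (\<lambda>_. n)) (b, d)) = E * (int N - int n) - int M * int b - int d"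
      unfolding component(3)[OF r(1,2) l] order_root_prod[OF l] by (simp add: algebra_simps)
  qed
  moreover have "- P_inf (component N (root_prod (\<lambda>_. n)) (b, d)) =
      E * int m * (int n - int N) + int q * int M * int b + int q ^ 3 * int d"
    unfolding component(2)[OF r(1,2)] r(3) by (simp add: algebra_simps)
  ultimately show ?thesis unfolding pole_orders_eq by (simp add: map_replicate_const)
qed

lemma pole_orders_component_cong:
  assumes "\<And>l. l \<in> {1..m} \<Longrightarrow> n l = n' l"
  shows "pole_orders (component N (root_prod n) i) = pole_orders (component N (root_prod n') i)"
proof -
  have "root_prod n = root_prod n'" unfolding root_prod_def using assms by (intro prod.cong) auto
  thus ?thesis by simp
qed

lemma alpha_tuple_eq:
  assumes "b \<le> q" "d < M"
  shows "alpha_tuple q M m (int q - int b) (int M - int d) =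
    pole_orders (component 1 (root_prod (\<lambda>_. 0)) (b, d))"
  unfolding pole_orders_component_const alpha_tuple_def
  by (simp add: algebra_simps power2_eq_square power3_eq_cube)

text \<open>
  The box bounds \<open>E (N - n l) - (M b + d)\<close> between \<open>0\<close> and \<open>E\<close>, where \<open>0 \<le> M b + d < E\<close>; this fixes
  the exponents \<open>n l - N\<close> to be all \<open>0\<close> or all \<open>-1\<close>.
\<close>
lemma abs_maximal_in_box:
  "abs_maximal k pts \<inter> box q M m =
     {alpha_tuple q M m i j | i j. (i, j) \<in> index_set q M} \<union> {replicate (m + 1) 0}"
proof (intro equalityI subsetI)
  fix \<beta> assume "\<beta> \<in> abs_maximal k pts \<inter> box q M m"
  hence \<beta>: "\<beta> \<in> abs_maximal k pts" and box: "\<beta> \<in> box q M m" by auto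
  obtain N n i where i: "i \<in> Idx" "\<beta> = pole_orders (component N (root_prod n) i)"
    by (rule abs_maximal_is_component[OF \<beta>])
  obtain b d where bd: "i = (b, d)" "b \<le> q" "d < M" using i by auto
  define s where "s = int M * int b + int d"
  have "int M * int b \<le> int M * int q" using bd by (intro mult_left_mono) auto
  moreover have "E = int M * int q + int M" by (simp add: algebra_simps)
  ultimately have s: "0 \<le> s" "s < E" using bd(3) unfolding s_def by (simp, linarith)
  have E0: "E > 0" using M_pos by simp
  have nl: "0 \<le> E * (int N - int (n l)) - s" "E * (int N - int (n l)) - s < E" if l: "l \<in> {1..m}" for l
  proof -
    have "\<beta> ! l = E * (int N - int (n l)) - s"
      using l by (simp add: i(2) pole_orders_l component(3)[OF root_prod(1,2) l] order_root_prod[OF l] bd s_def algebra_simps)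
    moreover have "0 \<le> \<beta> ! l \<and> \<beta> ! l < E" using box l by (simp add: box_def)
    ultimately show "0 \<le> E * (int N - int (n l)) - s" "E * (int N - int (n l)) - s < E" by auto
  qed
  show "\<beta> \<in> {alpha_tuple q M m i j | i j. (i, j) \<in> index_set q M} \<union> {replicate (m + 1) 0}"
  proof (cases "s = 0")
    case True
    hence bd0: "b = 0" "d = 0" using M_pos by (auto simp: s_def add_nonneg_eq_0_iff)
    have "n l = N" if "l \<in> {1..m}" for l
    proof -
      have "0 \<le> E * (int N - int (n l))" "E * (int N - int (n l)) < E * 1" using nl[OF that] True by auto
      hence "0 \<le> int N - int (n l)" "int N - int (n l) < 1"
        using E0 zero_le_mult_iff[of E "int N - int (n l)"] mult_less_cancel_left_pos[OF E0, of "int N - int (n l)" 1]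
        by linarith+
      thus ?thesis by simp
    qed
    hence "\<beta> = pole_orders (component N (root_prod (\<lambda>_. N)) (0, 0))"
      unfolding i(2) bd bd0 by (rule pole_orders_component_cong)
    also have "\<dots> = replicate (m + 1) 0" unfolding pole_orders_component_const by simp
    finally show ?thesis by simp
  next
    case False
    have n1: "int N - int (n l) = 1" if "l \<in> {1..m}" for l
    proof -
      have "0 < E * (int N - int (n l))" "E * (int N - int (n l)) < E * 2" using nl[OF that] s False by linarith+
      hence "0 < int N - int (n l)" "int N - int (n l) < 2"
        using E0 zero_less_mult_iff[of E "int N - int (n l)"] mult_less_cancel_left_pos[OF E0, of "int N - int (n l)" 2]
        by linarith+
      thus ?thesis by simp
    qed
    have N: "int N - int (N - 1) = 1" "int (N - 1) - int N = -1" using n1[of 1] m_pos by auto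
    have "n l = N - 1" if "l \<in> {1..m}" for l using n1[OF that] by linarith
    hence "\<beta> = pole_orders (component N (root_prod (\<lambda>_. N - 1)) (b, d))"
      unfolding i(2) bd(1) by (rule pole_orders_component_cong)
    also have "\<dots> = pole_orders (component 1 (root_prod (\<lambda>_. 0)) (b, d))"
      unfolding pole_orders_component_const N by simp
    also have "\<dots> = alpha_tuple q M m (int q - int b) (int M - int d)"
      by (rule alpha_tuple_eq[OF bd(2,3), symmetric])
    finally have "\<beta> = alpha_tuple q M m (int q - int b) (int M - int d)" .
    moreover have "(int q - int b, int M - int d) \<in> index_set q M"
      using bd False by (auto simp: index_set_def s_def)
    ultimately show ?thesis by blast
  qed
next
  fix \<beta> assume "\<beta> \<in> {alpha_tuple q M m i j | i j. (i, j) \<in> index_set q M} \<union> {replicate (m + 1) 0}"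
  then consider i j where "\<beta> = alpha_tuple q M m i j" "(i, j) \<in> index_set q M" | "\<beta> = replicate (m + 1) 0"
    by auto
  thus "\<beta> \<in> abs_maximal k pts \<inter> box q M m"
  proof cases
    case 1
    define b where "b = nat (int q - i)"
    define d where "d = nat (int M - j)"
    have ij: "0 \<le> i" "i \<le> int q" "1 \<le> j" "j \<le> int M" "i \<noteq> int q \<or> j \<noteq> int M"
      using 1(2) by (auto simp: index_set_def)
    have bd: "b \<le> q" "d < M" "i = int q - int b" "j = int M - int d"
      using ij by (auto simp: b_def d_def)
    have eq: "\<beta> = pole_orders (component 1 (root_prod (\<lambda>_. 0)) (b, d))"
      unfolding 1(1) bd(3,4) by (rule alpha_tuple_eq[OF bd(1,2)])
    have "(b, d) \<in> Idx" using bd by simp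
    hence "\<beta> \<in> abs_maximal k pts" unfolding eq by (rule component_abs_maximal)
    moreover have "\<beta> \<in> box q M m"
    proof -
      have iM: "0 \<le> i * int M" using ij by simp
      have "i * int M + j < E"
      proof (cases "i = int q")
        case True
        thus ?thesis using ij by (simp add: algebra_simps)
      next
        case False
        hence "(i + 1) * int M \<le> int q * int M" using ij by (intro mult_right_mono) auto
        thus ?thesis using ij M_pos by (simp add: algebra_simps)
      qed
      thus ?thesis using iM ij by (auto simp: box_def 1(1) alpha_tuple_def nth_Cons')
    qed
    ultimately show ?thesis by simp
  next
    case 2
    have eq: "\<beta> = pole_orders (component 0 (root_prod (\<lambda>_. 0)) (0, 0))"
      unfolding 2 pole_orders_component_const by simp
    have "(0, 0) \<in> Idx" using M_pos by simp
    hence "\<beta> \<in> abs_maximal k pts" unfolding eq by (rule component_abs_maximal)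
    moreover have "\<beta> \<in> box q M m" using M_pos by (auto simp: box_def 2 nth_Cons' simp del: replicate_Suc)
    ultimately show ?thesis by simp
  qed
qed

end

section \<open>Numerical hypotheses\<close>

text \<open>Translation by \<open>1\<close> permutes \<open>k\<close>, so adding \<open>1\<close> to each element does not change their sum.\<close>
lemma of_nat_card_subfield:
  assumes k: "is_subfield (k :: 'f::field set)" and fin: "finite k"
  shows "of_nat (card k) = (0 :: 'f)"
proof -
  note K = is_subringD[OF is_subfield_imp_subring[OF k]]
  have "bij_betw (\<lambda>a. a + 1) k k"
    by (rule bij_betwI[of _ _ _ "\<lambda>a. a - 1"]) (auto intro: K)
  hence "(\<Sum>a\<in>k. a) = (\<Sum>a\<in>k. a + 1)" by (rule sum.reindex_bij_betw[symmetric])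
  thus ?thesis by (simp add: sum.distrib)
qed

text \<open>For odd \<open>n\<close> the number \<open>q + 1\<close> divides \<open>q^n + 1\<close>, so \<open>M\<close> divides \<open>q^n + 1\<close> as well.\<close>
lemma M_properties:
  fixes q n s M :: nat
  assumes q: "q \<ge> 2" and n: "odd n" and s: "s dvd (q ^ n + 1) div (q + 1)"
    and M: "M = (q ^ n + 1) div (s * (q + 1))"
  shows "M > 0" "coprime M q"
proof -
  define t where "t = (q ^ n + 1) div (q + 1)"
  have "int q + 1 dvd int q ^ n + 1"
  proof -
    have "int q - (-1) dvd int q ^ n - (-1) ^ n" by (simp add: power_diff_sumr2)
    thus ?thesis using n by simp
  qed
  hence "int (q + 1) dvd int (q ^ n + 1)" by (simp add: add.commute)
  hence "q + 1 dvd q ^ n + 1" by (simp only: of_nat_dvd_iff)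
  hence t: "q ^ n + 1 = t * (q + 1)" unfolding t_def by (simp only: dvd_div_mult_self)
  have "M = t div s" unfolding M t_def by (metis div_mult2_eq mult.commute)
  hence "t = M * s" using s by (simp add: t_def)
  with t have eq: "q ^ n + 1 = M * (s * (q + 1))" by (simp only: mult.assoc)
  thus "M > 0" by (metis add_gr_0 mult_0 neq0_conv zero_less_one)
  have "n > 0" using n by (cases n) auto
  show "coprime M q"
  proof (rule coprimeI)
    fix c assume c: "c dvd M" "c dvd q"
    have "c dvd q ^ n" using c(2) \<open>n > 0\<close> by (metis dvd_power dvd_trans)
    moreover have "c dvd q ^ n + 1" unfolding eq using c(1) by simp
    ultimately show "is_unit c" using dvd_add_right_iff[of c "q ^ n" 1] by blast
  qed
qed

theorem theorem4p1:
  fixes q n s M m :: nat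
    and k :: "'f::field set" and x y z :: 'f
    and \<alpha> :: "nat \<Rightarrow> 'f"
    and P_inf :: "'f \<Rightarrow> int" and P :: "nat \<Rightarrow> 'f \<Rightarrow> int"
  assumes "primepow q"
    and "n \<ge> 3" and "odd n"
    and "s > 0" and "s dvd (q ^ n + 1) div (q + 1)"
    and "M = (q ^ n + 1) div (s * (q + 1))"
    and "function_field_Y q n M k x y z"
    and "P_inf \<in> places k" and "P_inf x < 0" and "P_inf y < 0" and "P_inf z < 0"
    and "bij_betw \<alpha> {1..q} {a \<in> k. a ^ q + a = 0}"
    and "\<And>i. i \<in> {1..q} \<Longrightarrow> P i \<in> rational_places k \<and>
           has_value_at (P i) x (\<alpha> i) \<and> has_value_at (P i) y 0 \<and> has_value_at (P i) z 0"
    and "1 \<le> m" and "m \<le> q"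
  shows "abs_maximal k (P_inf # map P [1..<m + 1]) \<inter> box q M m =
         {alpha_tuple q M m i j | i j. (i, j) \<in> index_set q M} \<union> {replicate (m + 1) 0}"
proof -
  obtain p e where p: "prime p" "e > 0" "q = p ^ e"
    using assms(1) by (auto simp: primepow_def)
  have q2: "q \<ge> 2" using primepow_gt_Suc_0[OF assms(1)] by simp
  have ff: "is_subfield k" "card k = q ^ (2 * n)" "generates_field_over k {x, y, z}"
    "x ^ q + x = y ^ (q + 1)" "y ^ (q\<^sup>2) - y = z ^ M"
    using assms(7) by (auto simp: function_field_Y_def)
  have "card k > 0" unfolding ff(2) using q2 by simp
  hence "finite k" using card_gt_0_iff by blast
  hence "of_nat (card k) = (0 :: 'f)" by (rule of_nat_card_subfield[OF ff(1)])
  hence char: "of_nat p = (0 :: 'f)" unfolding ff(2) p(3) by simp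
  note M = M_properties[OF q2 assms(3,5,6)]
  have \<alpha>: "\<alpha> l \<in> k" "\<alpha> l ^ q + \<alpha> l = 0" if "l \<in> {1..m}" for l
    using bij_betwE[OF assms(12)] that assms(15) by auto
  have inj: "inj_on \<alpha> {1..m}"
    using bij_betw_imp_inj_on[OF assms(12)] by (rule inj_on_subset) (use assms(15) in auto)
  have "x \<noteq> a" if "a \<in> k" for a
    using that assms(8,9) by (auto simp: places_iff)
  hence P: "P l \<in> places k" "P l (x - \<alpha> l) > 0" if "l \<in> {1..m}" for l
    using assms(13)[of l] assms(15) that \<alpha>(1)[OF that] by (auto simp: rational_places_def has_value_at_def)
  interpret curve_points p e q M k x y z P_inf m \<alpha> P
    by unfold_locales (use p char M ff assms \<alpha> inj P in auto)
  show ?thesis using abs_maximal_in_box unfolding pts_def .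
qed

end
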